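(* There is an absolute constant $c_0>0$ such that the following holds. Let $1\le p<\infty$, let $n\in\mathbb N$, and let $\|\cdot\|_X$ be a $1$-symmetric, $1$-unconditional norm on $\mathbb R^n$ with normalized unit vectors, $\|e_i\|_X=1$. Then for all independent (real-valued) random variables $f_1,\dots,f_n$ on a probability space $(\Omega,\mu)$, with $h^*$ the non-increasing rearrangement of their disjoint sum $h$, $$\frac{1}{2+4\sqrt2}\left(\Big(n\int_0^{1/n}h^*(s)^p\,ds\Big)^{1/p}+\Big\|\sum_{i=1}^n\Big(n\int_{\frac{i-1}{n}}^{\frac in}h^*(s)\,ds\Big)e_i\Big\|_X\right)\le\left(\int_\Omega\Big\|\sum_{i=1}^n f_ie_i\Big\|_X^p\,d\mu\right)^{1/p}$$ and $$\left(\int_\Omega\Big\|\sum_{i=1}^n f_ie_i\Big\|_X^p\,d\mu\right)^{1/p}\le\frac{c_0\,p}{1+\ln p}\left(\Big(n\int_0^{1/n}h^*(s)^p\,ds\Big)^{1/p}+\Big\|\sum_{i=1}^n\Big(n\int_{\frac{i-1}{n}}^{\frac in}h^*(s)\,ds\Big)e_i\Big\|_X\right).$$ Moreover, the order $\frac{p}{1+\ln p}$ of the constant in the second inequality is optimal: there is an absolute constant $c>0$ such that for every $1\le p<\infty$, if $C$ is a constant for which the second inequality holds with $C$ in place of $\frac{c_0p}{1+\ln p}$ for all $n$, all such norms $\|\cdot\|_X$ on $\mathbb R^n$ and all independent $f_1,\dots,f_n$, then $C\ge c\,\frac{p}{1+\ln p}$.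
   Context: $e_1,\dots,e_n$ are the standard unit vectors of $\mathbb R^n$. A norm on $\mathbb R^n$ is $1$-symmetric and $1$-unconditional if $\|\sum_i\varepsilon_i x_{\pi(i)}e_i\|_X=\|\sum_i x_ie_i\|_X$ for all real $x_i$, all signs $\varepsilon_i=\pm1$ and all permutations $\pi$ of $\{1,\dots,n\}$. The disjoint sum of $f_1,\dots,f_n$ is the function $h$ on $[0,1]\times\Omega$ (with the product of Lebesgue measure and $\mu$, denoted $\mathrm{Prob}$) given by $h(t,\omega)=\sum_{i=1}^n 1_{[\frac{i-1}{n},\frac in)}(t)f_i(\omega)$, and its non-increasing rearrangement is $h^*(s)=\inf\{t\ge 0 : \mathrm{Prob}(|h|>t)\le s\}$. *)

theory Defs
  imports "HOL-Probability.Probability" "HOL-Combinatorics.Permutations"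
begin

text \<open>
  Since the dimension n is quantified inside the statement, a vector of R^n is given by a
  function x of type nat => real of which only the coordinates x 1, ..., x n count. The vector
  sum x_i e_i is then the function x itself. The first condition says that N is well
  defined on R^n.
\<close>

definition norm_on_Rn :: "nat \<Rightarrow> ((nat \<Rightarrow> real) \<Rightarrow> real) \<Rightarrow> bool" where
  "norm_on_Rn n N \<longleftrightarrow>
     (\<forall>x y. (\<forall>i\<in>{1..n}. x i = y i) \<longrightarrow> N x = N y) \<and>
     (\<forall>x. 0 \<le> N x) \<and>
     (\<forall>x. N x = 0 \<longleftrightarrow> (\<forall>i\<in>{1..n}. x i = 0)) \<and>
     (\<forall>a x. N (\<lambda>i. a * x i) = \<bar>a\<bar> * N x) \<and>
     (\<forall>x y. N (\<lambda>i. x i + y i) \<le> N x + N y)"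

definition symmetric_unconditional :: "nat \<Rightarrow> ((nat \<Rightarrow> real) \<Rightarrow> real) \<Rightarrow> bool" where
  "symmetric_unconditional n N \<longleftrightarrow>
     (\<forall>x \<epsilon> \<pi>. (\<forall>i\<in>{1..n}. \<epsilon> i \<in> {-1, 1}) \<and> \<pi> permutes {1..n} \<longrightarrow>
        N (\<lambda>i. \<epsilon> i * x (\<pi> i)) = N x)"

definition unit_vector :: "nat \<Rightarrow> nat \<Rightarrow> real" where
  "unit_vector i = (\<lambda>j. if j = i then 1 else 0)"

definition normalized_symmetric_norm :: "nat \<Rightarrow> ((nat \<Rightarrow> real) \<Rightarrow> real) \<Rightarrow> bool" where
  "normalized_symmetric_norm n N \<longleftrightarrow>
     norm_on_Rn n N \<and> symmetric_unconditional n N \<and> (\<forall>i\<in>{1..n}. N (unit_vector i) = 1)"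

definition disjoint_sum :: "nat \<Rightarrow> (nat \<Rightarrow> 'a \<Rightarrow> real) \<Rightarrow> real \<times> 'a \<Rightarrow> real" where
  "disjoint_sum n f = (\<lambda>(t, \<omega>).
     \<Sum>i = 1..n. indicator {(real i - 1) / real n ..< real i / real n} t * f i \<omega>)"

definition unit_interval_product :: "'a measure \<Rightarrow> (real \<times> 'a) measure" where
  "unit_interval_product M = restrict_space lborel {0..1} \<Otimes>\<^sub>M M"

text \<open>
  The random variables need not be integrable, so all quantities are computed in [0, \<infinity>]. In
  particular the rearrangement of an unbounded function is \<infinity> at 0 (infimum of the empty set).
\<close>

definition rearrangement :: "'b measure \<Rightarrow> ('b \<Rightarrow> real) \<Rightarrow> real \<Rightarrow> ennreal" where
  "rearrangement P h s =
     Inf {ennreal t | t. 0 \<le> t \<and> emeasure P {x \<in> space P. t < \<bar>h x\<bar>} \<le> ennreal s}"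

definition ennreal_powr :: "ennreal \<Rightarrow> real \<Rightarrow> ennreal" where
  \<comment> \<open>only used for positive exponents\<close>
  "ennreal_powr x a = (if x = \<infinity> then \<infinity> else ennreal (enn2real x powr a))"

definition ennreal_norm :: "nat \<Rightarrow> ((nat \<Rightarrow> real) \<Rightarrow> real) \<Rightarrow> (nat \<Rightarrow> ennreal) \<Rightarrow> ennreal" where
  \<comment> \<open>N on [0, \<infinity>)^n, extended by \<infinity> to vectors with an infinite coordinate\<close>
  "ennreal_norm n N a =
     (if \<exists>i\<in>{1..n}. a i = \<infinity> then \<infinity> else ennreal (N (\<lambda>i. enn2real (a i))))"

definition moment_of_norm ::
  "real \<Rightarrow> ((nat \<Rightarrow> real) \<Rightarrow> real) \<Rightarrow> 'a measure \<Rightarrow> (nat \<Rightarrow> 'a \<Rightarrow> real) \<Rightarrow> ennreal" where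
  "moment_of_norm p N M f =
     ennreal_powr (\<integral>\<^sup>+ \<omega>. ennreal (N (\<lambda>i. f i \<omega>) powr p) \<partial>M) (1 / p)"

definition rearrangement_expr ::
  "real \<Rightarrow> nat \<Rightarrow> ((nat \<Rightarrow> real) \<Rightarrow> real) \<Rightarrow> 'a measure \<Rightarrow> (nat \<Rightarrow> 'a \<Rightarrow> real) \<Rightarrow> ennreal" where
  "rearrangement_expr p n N M f =
     (let hs = rearrangement (unit_interval_product M) (disjoint_sum n f)
      in ennreal_powr (of_nat n * (\<integral>\<^sup>+ s \<in> {0..1 / real n}. ennreal_powr (hs s) p \<partial>lborel)) (1 / p)
         + ennreal_norm n N
             (\<lambda>i. of_nat n * (\<integral>\<^sup>+ s \<in> {(real i - 1) / real n..real i / real n}. hs s \<partial>lborel)))"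

definition admissible ::
  "nat \<Rightarrow> ((nat \<Rightarrow> real) \<Rightarrow> real) \<Rightarrow> 'a measure \<Rightarrow> (nat \<Rightarrow> 'a \<Rightarrow> real) \<Rightarrow> bool" where
  "admissible n N M f \<longleftrightarrow>
     1 \<le> n \<and> normalized_symmetric_norm n N \<and>
     prob_space M \<and> prob_space.indep_vars M (\<lambda>_. borel) f {1..n}"

definition upper_constant :: "'a itself \<Rightarrow> real \<Rightarrow> real \<Rightarrow> bool" where
  "upper_constant _ p C \<longleftrightarrow>
     (\<forall>n N (M :: 'a measure) f. admissible n N M f \<longrightarrow>
        moment_of_norm p N M f \<le> ennreal C * rearrangement_expr p n N M f)"

text \<open>
  An absolute constant must not depend on the type of the points of the probability space
  either, and a type cannot be quantified below an existential quantifier. So c0 is named by a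
  closed term: some positive constant that works for all probability spaces on the type
  nat => real, where every joint law of f 1, ..., f n is realised. That such a constant exists,
  and that c0 then works for probability spaces on every type, has to be proved.
\<close>

definition c0 :: real where
  "c0 = (SOME c. 0 < c \<and> (\<forall>p\<ge>1. upper_constant TYPE(nat \<Rightarrow> real) p (c * p / (1 + ln p))))"

end

theory Submission
  imports Defs
begin

text \<open>
  Let S(t) be the sum of the Prob(|f i| > t) and N(t) the number of i with |f i| > t. Since
  h*(s) > t iff S(t) > n s, the vector of block averages of h* has partial sums equal to the
  integral of min(m, S(t)) over t, while the m largest of the |f i| add up to the integral of
  min(m, N(t)). By Hahn-Banach a symmetric norm is a maximum of nonnegative combinations of the
  sums of the m largest coordinates, so norms are compared by comparing min(m, S) with min(m, N).

  Lower bound: min(m, S) is at most twice the expectation of min(m, N).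

  Upper bound: at a level t0 with S(t0) at most 1 split every f i into a large and a small part.
  The number of large parts has exponential moments like a Poisson variable of mean 1, which gives
  a p-th moment of order p / (1 + ln p). For the small parts N(t) is at most R S(t) for all t < t0,
  where R is controlled on the levels with S(t) about 2^j by exponential moments.

  Optimality: in the l1 norm take n of order p / (1 + ln p) independent Bernoulli variables of
  mean 1/n, and keep only the event that all of them are 1.
\<close>

section \<open>Symmetric norms and sums of largest coordinates\<close>

text \<open>The two directions take the Hahn-Banach weights at different vectors, and this decides
  how much probability is needed. For the lower bound they belong to the deterministic block vector,
  so expectation passes through the weighted sum and a comparison of means suffices. For the upper
  bound they belong to the random vector of small parts, so all levels must be dominated
  simultaneously at each sample point; hence the random factor R with a controlled p-th moment. With
  l = 1 + ln p, the inequality y <= exp y at y = l x / p gives x^p <= (p/l)^p exp (l x). Since exp l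
  = e p, Poisson-type exponential moments at parameter l cost only exp (O(p)), an absolute constant
  after the p-th root, and p/l is all that remains. In the lower bound each of the two terms is at
  most twice the moment, and 4 <= 2 + 4 sqrt 2. The rearrangement expression depends on the family
  only through S. It is therefore unchanged when the family is replaced by the coordinates under its
  joint law, which is how \<open>c0\<close>, chosen on one type, serves all types.\<close>

definition exceedances :: "nat \<Rightarrow> (nat \<Rightarrow> real) \<Rightarrow> real \<Rightarrow> real" where
  "exceedances n y u = real (card {i\<in>{1..n}. u < \<bar>y i\<bar>})"

text \<open>For m at most n this is the Ky Fan norm of order m. The integral form allows a
  level-by-level comparison with the tail sum, and sorting is needed only to evaluate it.\<close>

definition top_sum :: "nat \<Rightarrow> nat \<Rightarrow> (nat \<Rightarrow> real) \<Rightarrow> ennreal" where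
  "top_sum n m y = (\<integral>\<^sup>+u\<in>{0..}. ennreal (min (real m) (exceedances n y u)) \<partial>lborel)"

lemma exceedances_eq_sum: "exceedances n y u = (\<Sum>i=1..n. if u < \<bar>y i\<bar> then 1 else 0)"
  unfolding exceedances_def by (simp add: sum.If_cases Int_def)

lemma exceedances_nonneg [simp]: "0 \<le> exceedances n y u"
  by (simp add: exceedances_def)

lemma exceedances_le: "exceedances n y u \<le> real n"
proof -
  have "card {i\<in>{1..n}. u < \<bar>y i\<bar>} \<le> card {1..n}" by (intro card_mono) auto
  then show ?thesis by (simp add: exceedances_def)
qed

lemma exceedances_antimono: "u \<le> v \<Longrightarrow> exceedances n y v \<le> exceedances n y u"
  unfolding exceedances_def by (auto intro!: card_mono)

lemma exceedances_permute:
  assumes "\<sigma> permutes {1..n}"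
  shows "exceedances n (\<lambda>i. y (\<sigma> i)) u = exceedances n y u"
  unfolding exceedances_eq_sum
  using sum.permute[OF assms, of "\<lambda>i. if u < \<bar>y i\<bar> then 1 else (0::real)"] by (simp add: o_def)

lemma exceedances_abs: "exceedances n (\<lambda>i. \<bar>y i\<bar>) = exceedances n y"
  by (simp add: exceedances_def fun_eq_iff)

lemma exists_sorting_permutation:
  fixes y :: "nat \<Rightarrow> real"
  obtains \<sigma> where "\<sigma> permutes {1..n}" "antimono_on {1..n} (\<lambda>i. y (\<sigma> i))"
proof -
  define xs where "xs = sort_key (\<lambda>i. - y i) [1..<Suc n]"
  have len: "length xs = n" and dist: "distinct xs" and set: "set xs = {1..n}"
    by (auto simp: xs_def)
  have srt: "sorted (map (\<lambda>i. - y i) xs)" by (simp add: xs_def)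
  \<comment> \<open>List positions start at 0 and coordinates at 1, hence the shift. Outside the
    index range a permutation of that range must be the identity.\<close>
  define \<sigma> where "\<sigma> i = (if i \<in> {1..n} then xs ! (i - 1) else i)" for i
  have "bij_betw (\<lambda>i. xs ! (i - 1)) {1..n} {1..n}"
  proof -
    have "bij_betw (\<lambda>i. i - 1) {1..n} {..<n}"
      by (rule bij_betwI[where g = Suc]) auto
    moreover have "bij_betw ((!) xs) {..<n} {1..n}"
      using bij_betw_nth[OF dist, of "{..<n}" "{1..n}"] len set by simp
    ultimately show ?thesis by (auto dest: bij_betw_trans simp: o_def)
  qed
  then have "bij_betw \<sigma> {1..n} {1..n}" by (rule bij_betw_cong[THEN iffD1, rotated]) (simp add: \<sigma>_def)
  then have 1: "\<sigma> permutes {1..n}" by (rule bij_imp_permutes) (auto simp: \<sigma>_def)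
  have 2: "antimono_on {1..n} (\<lambda>i. y (\<sigma> i))"
  proof (rule monotone_onI)
    fix i j assume ij: "i \<in> {1..n}" "j \<in> {1..n}" "i \<le> j"
    then have "map (\<lambda>i. - y i) xs ! (i - 1) \<le> map (\<lambda>i. - y i) xs ! (j - 1)"
      using sorted_nth_mono[OF srt, of "i - 1" "j - 1"] len by auto
    then show "y (\<sigma> j) \<le> y (\<sigma> i)" using ij len by (simp add: \<sigma>_def)
  qed
  show ?thesis using that 1 2 by blast
qed

text \<open>The boundary term disappears in the applications because the weights there are extended
  by 0 beyond n.\<close>

lemma abel_summation:
  fixes b z :: "nat \<Rightarrow> real"
  shows "(\<Sum>k=1..n. b k * z k) =
    (\<Sum>m=1..n. (b m - b (Suc m)) * (\<Sum>k=1..m. z k)) + b (Suc n) * (\<Sum>k=1..n. z k)"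
  by (induction n) (simp_all add: algebra_simps)

text \<open>Since z decreases, the indices with value above u form an initial segment, and capping
  its length at m is the same as counting only indices up to m. Integrating over u then recovers
  each z k separately.\<close>

lemma top_sum_sorted:
  assumes z: "antimono_on {1..n} z" "\<And>i. i \<in> {1..n} \<Longrightarrow> 0 \<le> z i" and m: "m \<le> n"
  shows "top_sum n m z = ennreal (\<Sum>k=1..m. z k)"
proof -
  have *: "min (real m) (exceedances n z u) = (\<Sum>k=1..m. if u < z k then 1 else 0)" if "0 \<le> u" for u
  proof -
    have e: "(\<Sum>k=1..m. if u < z k then 1 else (0::real)) = real (card {k\<in>{1..m}. u < z k})"
      by (simp add: sum.If_cases Int_def)
    have e': "exceedances n z u = real (card {k\<in>{1..n}. u < z k})"
      unfolding exceedances_def using z(2) by (intro arg_cong[of _ _ real] arg_cong[of _ _ card]) fastforce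
    show ?thesis
    proof (cases "m = 0 \<or> u < z m")
      case True
      have "{k\<in>{1..m}. u < z k} = {1..m}"
      proof -
        have "u < z k" if "k \<in> {1..m}" for k
          using True m that monotone_onD[OF z(1), of k m] by fastforce
        then show ?thesis by auto
      qed
      moreover have "card {k\<in>{1..m}. u < z k} \<le> card {k\<in>{1..n}. u < z k}"
        using m by (intro card_mono) auto
      ultimately show ?thesis using e e' by simp
    next
      case False
      have "k \<le> m" if "k \<in> {1..n}" "u < z k" for k
        using False m that monotone_onD[OF z(1), of m k] by (cases "k \<le> m") auto
      then have "{k\<in>{1..n}. u < z k} = {k\<in>{1..m}. u < z k}" using m by fastforce
      moreover have "card {k\<in>{1..m}. u < z k} \<le> card {1..m}" by (intro card_mono) auto
      ultimately show ?thesis using e e' by simp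
    qed
  qed
  have "top_sum n m z = (\<integral>\<^sup>+u. (\<Sum>k=1..m. indicator {0..<z k} u) \<partial>lborel)"
    unfolding top_sum_def
  proof (intro nn_integral_cong)
    fix u :: real
    show "ennreal (min (real m) (exceedances n z u)) * indicator {0..} u = (\<Sum>k=1..m. indicator {0..<z k} u)"
    proof (cases "0 \<le> u")
      case True
      have "ennreal (\<Sum>k=1..m. if u < z k then 1 else 0) = (\<Sum>k=1..m. ennreal (if u < z k then 1 else 0))"
        by (rule sum_ennreal[symmetric]) auto
      also have "\<dots> = (\<Sum>k=1..m. indicator {0..<z k} u)"
        using True by (intro sum.cong) auto
      finally show ?thesis using True by (simp only: *) simp
    qed (auto simp: indicator_def intro!: sum.neutral)
  qed
  also have "\<dots> = (\<Sum>k=1..m. ennreal (z k))"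
    using z(2) m by (subst nn_integral_sum) (auto intro!: sum.cong)
  also have "\<dots> = ennreal (\<Sum>k=1..m. z k)"
    using z(2) m by (intro sum_ennreal) auto
  finally show ?thesis .
qed

text \<open>Exchange argument: the elements of A beyond m have weight at most w m, the indices up to
  m missing from A have weight at least w m, and there are equally many of both.\<close>

lemma sum_subset_le_initial_sum:
  fixes w :: "nat \<Rightarrow> real"
  assumes w: "antimono_on {1..n} w" and A: "A \<subseteq> {1..n}" "card A = m"
  shows "(\<Sum>i\<in>A. w i) \<le> (\<Sum>i=1..m. w i)"
proof (cases "m = 0")
  case True
  then have "A = {}" using A finite_subset[OF A(1)] by simp
  then show ?thesis using True by simp
next
  case False
  have fin: "finite A" using A finite_subset by auto
  have mn: "m \<le> n" using card_mono[OF _ A(1)] A(2) by simp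
  have c: "card (A - {1..m}) = card ({1..m} - A)"
    using card_Int_Diff[OF fin, of "{1..m}"] card_Int_Diff[of "{1..m}" A] A(2) by (simp add: Int_commute)
  have "(\<Sum>i\<in>A - {1..m}. w i) \<le> of_nat (card (A - {1..m})) * w m"
    using A mn False by (intro sum_bounded_above monotone_onD[OF w]) auto
  also have "\<dots> \<le> (\<Sum>i\<in>{1..m} - A. w i)"
    unfolding c using A mn False by (intro sum_bounded_below monotone_onD[OF w]) auto
  finally show ?thesis
    using sum.Int_Diff[OF fin, of w "{1..m}"] sum.Int_Diff[of "{1..m}" w A] by (simp add: Int_commute)
qed

section \<open>Symmetric norms as maxima of weighted sums of largest coordinates\<close>

locale symmetric_norm =
  fixes n :: nat and N :: "(nat \<Rightarrow> real) \<Rightarrow> real"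
  assumes normalized: "normalized_symmetric_norm n N"
begin

lemma N_cong: "(\<And>i. i \<in> {1..n} \<Longrightarrow> x i = y i) \<Longrightarrow> N x = N y"
  and N_nonneg [simp]: "0 \<le> N x"
  and N_scale: "N (\<lambda>i. a * x i) = \<bar>a\<bar> * N x"
  and N_triangle: "N (\<lambda>i. x i + y i) \<le> N x + N y"
  and N_invariant: "(\<And>i. i \<in> {1..n} \<Longrightarrow> \<epsilon> i \<in> {-1, 1}) \<Longrightarrow> \<pi> permutes {1..n} \<Longrightarrow>
    N (\<lambda>i. \<epsilon> i * x (\<pi> i)) = N x"
  and N_unit: "i \<in> {1..n} \<Longrightarrow> N (unit_vector i) = 1"
proof -
  have n: "\<forall>x y. (\<forall>i\<in>{1..n}. x i = y i) \<longrightarrow> N x = N y" "\<forall>x. 0 \<le> N x"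
    "\<forall>a x. N (\<lambda>i. a * x i) = \<bar>a\<bar> * N x" "\<forall>x y. N (\<lambda>i. x i + y i) \<le> N x + N y"
    "\<forall>i\<in>{1..n}. N (unit_vector i) = 1"
    "\<forall>x \<epsilon> \<pi>. (\<forall>i\<in>{1..n}. \<epsilon> i \<in> {-1, 1}) \<and> \<pi> permutes {1..n} \<longrightarrow> N (\<lambda>i. \<epsilon> i * x (\<pi> i)) = N x"
    using normalized
    unfolding normalized_symmetric_norm_def norm_on_Rn_def symmetric_unconditional_def
    by simp_all
  show "(\<And>i. i \<in> {1..n} \<Longrightarrow> x i = y i) \<Longrightarrow> N x = N y" using n(1) by simp
  show "0 \<le> N x" "N (\<lambda>i. a * x i) = \<bar>a\<bar> * N x" "N (\<lambda>i. x i + y i) \<le> N x + N y"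
    using n(2-4) by simp_all
  show "i \<in> {1..n} \<Longrightarrow> N (unit_vector i) = 1" using n(5) by simp
  show "(\<And>i. i \<in> {1..n} \<Longrightarrow> \<epsilon> i \<in> {-1, 1}) \<Longrightarrow> \<pi> permutes {1..n} \<Longrightarrow>
    N (\<lambda>i. \<epsilon> i * x (\<pi> i)) = N x" using n(6) by simp
qed

lemma N_zero: "N (\<lambda>i. 0) = 0"
  using N_scale[of 0 "\<lambda>i. 0"] by simp

lemma N_signs: "(\<And>i. i \<in> {1..n} \<Longrightarrow> \<epsilon> i \<in> {-1, 1}) \<Longrightarrow> N (\<lambda>i. \<epsilon> i * x i) = N x"
  using N_invariant[of \<epsilon> id x] by simp

lemma N_permute: "\<pi> permutes {1..n} \<Longrightarrow> N (\<lambda>i. x (\<pi> i)) = N x"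
  using N_invariant[of "\<lambda>i. 1" \<pi> x] by simp

lemma N_abs: "N (\<lambda>i. \<bar>x i\<bar>) = N x"
proof -
  have "N (\<lambda>i. (if 0 \<le> x i then 1 else - 1) * x i) = N x" by (intro N_signs) auto
  moreover have "(\<lambda>i. (if 0 \<le> x i then 1 else - 1) * x i) = (\<lambda>i. \<bar>x i\<bar>)" by auto
  ultimately show ?thesis by simp
qed

text \<open>Flipping all signs except the i-th and adding the result to x leaves twice the i-th
  coordinate, while both summands have the same norm.\<close>

lemma coordinate_le_N:
  assumes "i \<in> {1..n}"
  shows "\<bar>x i\<bar> \<le> N x"
proof -
  let ?\<epsilon> = "\<lambda>j. if j = i then 1 else - 1 :: real"
  have "2 * \<bar>x i\<bar> = N (\<lambda>j. (2 * x i) * unit_vector i j)"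
    using N_unit[OF assms] by (subst N_scale) simp
  also have "(\<lambda>j. (2 * x i) * unit_vector i j) = (\<lambda>j. x j + ?\<epsilon> j * x j)"
    by (auto simp: unit_vector_def)
  also have "N \<dots> \<le> N x + N (\<lambda>j. ?\<epsilon> j * x j)" by (rule N_triangle)
  also have "N (\<lambda>j. ?\<epsilon> j * x j) = N x" by (rule N_signs) auto
  finally show ?thesis by simp
qed

lemma N_le_sum: "N x \<le> (\<Sum>i=1..n. \<bar>x i\<bar>)"
proof -
  have "N (\<lambda>j. if j \<in> {1..k} then x j else 0) \<le> (\<Sum>i=1..k. \<bar>x i\<bar>)" if "k \<le> n" for k
    using that
  proof (induction k)
    case 0
    then show ?case by (simp add: N_zero)
  next
    case (Suc k)
    have "N (\<lambda>j. if j \<in> {1..Suc k} then x j else 0) =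
        N (\<lambda>j. (if j \<in> {1..k} then x j else 0) + x (Suc k) * unit_vector (Suc k) j)"
      by (intro N_cong) (auto simp: unit_vector_def le_Suc_eq)
    also have "\<dots> \<le> N (\<lambda>j. if j \<in> {1..k} then x j else 0) + N (\<lambda>j. x (Suc k) * unit_vector (Suc k) j)"
      by (rule N_triangle)
    also have "N (\<lambda>j. x (Suc k) * unit_vector (Suc k) j) = \<bar>x (Suc k)\<bar>"
      using Suc.prems by (subst N_scale) (simp add: N_unit)
    finally show ?case using Suc by simp
  qed
  from this[of n] have "N (\<lambda>j. if j \<in> {1..n} then x j else 0) \<le> (\<Sum>i=1..n. \<bar>x i\<bar>)" by simp
  moreover have "N (\<lambda>j. if j \<in> {1..n} then x j else 0) = N x" by (intro N_cong) auto
  ultimately show ?thesis by simp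
qed

text \<open>
  Hahn-Banach, extending from the line through x by one unit vector at a time. At k = n the
  domination at the vector x - x = 0 is the lower bound at x.
\<close>

lemma supporting_functional:
  obtains b where "N x \<le> (\<Sum>i=1..n. b i * x i)" "\<And>y. (\<Sum>i=1..n. b i * y i) \<le> N y"
proof -
  \<comment> \<open>Working with the parameters (a, c) instead of the vectors themselves avoids
    asking whether x already lies in the span of the first k unit vectors.\<close>
  define v where "v k a c = (\<lambda>j. a * x j + (if j \<in> {1..k} then c j else 0))"
    for k :: nat and a :: real and c :: "nat \<Rightarrow> real"
  define l where "l k b a c = a * N x + (\<Sum>i=1..k. b i * c i)"
    for k :: nat and b :: "nat \<Rightarrow> real" and a and c :: "nat \<Rightarrow> real"
  have "\<exists>b. \<forall>a c. l k b a c \<le> N (v k a c)" for k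
  proof (induction k)
    case 0
    have "a * N x \<le> \<bar>a\<bar> * N x" for a by (intro mult_right_mono) auto
    then show ?case by (auto simp: v_def l_def N_scale)
  next
    case (Suc k)
    then obtain b where b: "\<And>a c. l k b a c \<le> N (v k a c)" by blast
    define e where "e = unit_vector (Suc k)"
    \<comment> \<open>Every lower bound that domination imposes on the value at the new unit vector
      is below every upper bound, so the supremum of the lower bounds is a legitimate value.\<close>
    have cross: "l k b a c - N (\<lambda>j. v k a c j - e j) \<le> N (\<lambda>j. v k a' c' j + e j) - l k b a' c'"
      for a c a' c'
    proof -
      have "l k b a c + l k b a' c' = l k b (a + a') (\<lambda>i. c i + c' i)"
        by (simp add: l_def algebra_simps sum.distrib)
      also have "\<dots> \<le> N (v k (a + a') (\<lambda>i. c i + c' i))" by (rule b)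
      also have "v k (a + a') (\<lambda>i. c i + c' i) = (\<lambda>j. (v k a c j - e j) + (v k a' c' j + e j))"
        by (auto simp: v_def algebra_simps)
      also have "N \<dots> \<le> N (\<lambda>j. v k a c j - e j) + N (\<lambda>j. v k a' c' j + e j)" by (rule N_triangle)
      finally show ?thesis by simp
    qed
    define L where "L = (\<lambda>(a, c). l k b a c - N (\<lambda>j. v k a c j - e j)) ` UNIV"
    define \<beta> where "\<beta> = Sup L"
    have bdd: "bdd_above L" unfolding L_def using cross[of _ _ 0 "\<lambda>_. 0"] by (auto intro!: bdd_aboveI2)
    have lo: "l k b a c - N (\<lambda>j. v k a c j - e j) \<le> \<beta>" for a c
      unfolding \<beta>_def by (rule cSup_upper[OF _ bdd]) (auto simp: L_def)
    have hi: "\<beta> \<le> N (\<lambda>j. v k a c j + e j) - l k b a c" for a c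
      unfolding \<beta>_def by (rule cSup_least) (auto simp: L_def intro: cross)
    have "l k b a c + \<beta> * g \<le> N (\<lambda>j. v k a c j + g * e j)" for a c g
    proof -
      \<comment> \<open>Homogeneity reduces the coefficient g of the new vector to 1 or -1, for
        which \<open>hi\<close> and \<open>lo\<close> are made.\<close>
      have sc: "l k b (a / h) (\<lambda>i. c i / h) = l k b a c / h"
        "v k (a / h) (\<lambda>i. c i / h) = (\<lambda>j. v k a c j / h)" for h
        by (auto simp: l_def v_def sum_divide_distrib add_divide_distrib)
      consider "g = 0" | "g > 0" | "g < 0" by linarith
      then show ?thesis
      proof cases
        case 1
        then show ?thesis using b[of a c] by simp
      next
        case 2
        have "\<beta> \<le> N (\<lambda>j. v k a c j / g + e j) - l k b a c / g"
          using hi[of "a / g" "\<lambda>i. c i / g"] by (simp add: sc)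
        then have "g * \<beta> \<le> g * (N (\<lambda>j. v k a c j / g + e j) - l k b a c / g)"
          using 2 by (intro mult_left_mono) auto
        also have "\<dots> = N (\<lambda>j. g * (v k a c j / g + e j)) - l k b a c"
          unfolding N_scale using 2 by (simp add: field_simps)
        also have "(\<lambda>j. g * (v k a c j / g + e j)) = (\<lambda>j. v k a c j + g * e j)"
          using 2 by (auto simp: field_simps)
        finally show ?thesis by (simp add: algebra_simps)
      next
        case 3
        have "l k b a c / (- g) - N (\<lambda>j. v k a c j / (- g) - e j) \<le> \<beta>"
          using lo[of "a / (- g)" "\<lambda>i. c i / (- g)"] by (simp only: sc)
        then have "(- g) * (l k b a c / (- g) - N (\<lambda>j. v k a c j / (- g) - e j)) \<le> (- g) * \<beta>"
          using 3 by (intro mult_left_mono) auto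
        also have "(- g) * (l k b a c / (- g) - N (\<lambda>j. v k a c j / (- g) - e j)) =
            l k b a c - N (\<lambda>j. (- g) * (v k a c j / (- g) - e j))"
          unfolding N_scale using 3 by (simp add: field_simps)
        also have "(\<lambda>j. (- g) * (v k a c j / (- g) - e j)) = (\<lambda>j. v k a c j + g * e j)"
          using 3 by (auto simp: field_simps)
        finally show ?thesis by (simp add: algebra_simps)
      qed
    qed
    note main = this
    have "l (Suc k) (b(Suc k := \<beta>)) a c \<le> N (v (Suc k) a c)" for a c
    proof -
      have "l (Suc k) (b(Suc k := \<beta>)) a c = l k b a c + \<beta> * c (Suc k)"
      proof -
        have "(\<Sum>i=1..k. (b(Suc k := \<beta>)) i * c i) = (\<Sum>i=1..k. b i * c i)"
          by (intro sum.cong) auto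
        then show ?thesis by (simp add: l_def)
      qed
      moreover have "v (Suc k) a c = (\<lambda>j. v k a c j + c (Suc k) * e j)"
        by (auto simp: v_def e_def unit_vector_def le_Suc_eq fun_eq_iff)
      ultimately show ?thesis using main by simp
    qed
    then show ?case by blast
  qed
  then obtain b where b: "\<And>a c. l n b a c \<le> N (v n a c)" by blast
  have "l n b 0 y \<le> N y" for y
  proof -
    have "N (v n 0 y) = N y" by (intro N_cong) (auto simp: v_def)
    then show ?thesis using b[of 0 y] by simp
  qed
  then have 2: "(\<Sum>i=1..n. b i * y i) \<le> N y" for y by (simp add: l_def)
  have "N (v n 1 (\<lambda>i. - x i)) = N (\<lambda>i. 0)" by (intro N_cong) (auto simp: v_def)
  then have "N x \<le> (\<Sum>i=1..n. b i * x i)"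
    using b[of 1 "\<lambda>i. - x i"] by (simp add: l_def N_zero sum_negf)
  with 2 show ?thesis using that by blast
qed

text \<open>A functional b supporting the sorted vector z is replaced by the decreasing
  rearrangement w of its absolute values. Symmetry keeps w dominated by the norm, and rearranging
  does not lower the value at z. Abel summation then writes w as a combination of initial sums with
  weights d, which on sorted nonnegative vectors are the top sums.\<close>

lemma top_sum_representation:
  obtains d :: "nat \<Rightarrow> real" where "\<And>m. m \<in> {1..n} \<Longrightarrow> 0 \<le> d m"
    "ennreal (N x) \<le> (\<Sum>m=1..n. ennreal (d m) * top_sum n m x)"
    "\<And>y. (\<Sum>m=1..n. ennreal (d m) * top_sum n m y) \<le> ennreal (N y)"
proof -
  obtain \<sigma> where \<sigma>: "\<sigma> permutes {1..n}" "antimono_on {1..n} (\<lambda>i. \<bar>x (\<sigma> i)\<bar>)"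
    using exists_sorting_permutation[of n "\<lambda>i. \<bar>x i\<bar>"] by blast
  define z where "z i = \<bar>x (\<sigma> i)\<bar>" for i
  have z: "antimono_on {1..n} z" "\<And>i. 0 \<le> z i" using \<sigma> by (auto simp: z_def[abs_def])
  have Nz: "N z = N x"
    unfolding z_def[abs_def] using N_permute[OF \<sigma>(1), of "\<lambda>i. \<bar>x i\<bar>"] by (simp add: N_abs)
  have tz: "top_sum n m x = ennreal (\<Sum>k=1..m. z k)" if "m \<le> n" for m
  proof -
    have "top_sum n m x = top_sum n m z"
      unfolding top_sum_def z_def[abs_def] exceedances_abs exceedances_permute[OF \<sigma>(1)] ..
    then show ?thesis using top_sum_sorted[OF z(1) _ that] z(2) by simp
  qed
  obtain b where b: "N z \<le> (\<Sum>i=1..n. b i * z i)" "\<And>y. (\<Sum>i=1..n. b i * y i) \<le> N y"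
    using supporting_functional[of z] by blast
  obtain \<rho> where \<rho>: "\<rho> permutes {1..n}" "antimono_on {1..n} (\<lambda>i. \<bar>b (\<rho> i)\<bar>)"
    using exists_sorting_permutation[of n "\<lambda>i. \<bar>b i\<bar>"] by blast
  \<comment> \<open>The value 0 at n + 1 removes the boundary term of the Abel summation and makes d
    n = w n nonnegative.\<close>
  define w where "w i = (if i \<in> {1..n} then \<bar>b (\<rho> i)\<bar> else 0)" for i
  have w: "antimono_on {1..n} w" "\<And>i. 0 \<le> w i"
    using \<rho>(2) by (auto simp: w_def monotone_on_def)
  define d where "d m = w m - w (Suc m)" for m
  have d: "0 \<le> d m" if "m \<in> {1..n}" for m
    using that monotone_onD[OF w(1), of m "Suc m"] w(2)[of m] by (cases "m = n") (auto simp: d_def w_def)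
  have abel: "(\<Sum>k=1..n. w k * y k) = (\<Sum>m=1..n. d m * (\<Sum>k=1..m. y k))" for y
    unfolding d_def by (subst abel_summation) (simp add: w_def)
  have wN: "(\<Sum>k=1..n. w k * y k) \<le> N y" for y
  proof -
    let ?s = "\<lambda>j. if 0 \<le> b j then 1 else - 1 :: real"
    have "(\<Sum>k=1..n. w k * y k) = (\<Sum>k=1..n. \<bar>b (\<rho> k)\<bar> * y k)"
      by (intro sum.cong) (auto simp: w_def)
    also have "\<dots> = (\<Sum>j=1..n. \<bar>b j\<bar> * y (inv \<rho> j))"
      using sum.permute[OF \<rho>(1), of "\<lambda>j. \<bar>b j\<bar> * y (inv \<rho> j)"] permutes_inverses(2)[OF \<rho>(1)]
      by (simp add: o_def)
    also have "\<dots> = (\<Sum>j=1..n. b j * (?s j * y (inv \<rho> j)))"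
      by (intro sum.cong) auto
    also have "\<dots> \<le> N (\<lambda>j. ?s j * y (inv \<rho> j))" by (rule b(2))
    also have "\<dots> = N y" by (rule N_invariant[OF _ permutes_inv[OF \<rho>(1)]]) auto
    finally show ?thesis .
  qed
  \<comment> \<open>Rearrangement inequality. Here Abel summation is applied with the decreasing
    vector z as weights, so that only the partial sums of b and w need to be compared.\<close>
  have zw: "(\<Sum>k=1..n. b k * z k) \<le> (\<Sum>k=1..n. w k * z k)"
  proof -
    define z' where "z' k = (if k \<in> {1..n} then z k else 0)" for k
    define D where "D m = z' m - z' (Suc m)" for m
    have D: "0 \<le> D m" if "m \<in> {1..n}" for m
      using that monotone_onD[OF z(1), of m "Suc m"] z(2)[of m] by (cases "m = n") (auto simp: D_def z'_def)
    have a: "(\<Sum>k=1..n. z' k * y k) = (\<Sum>m=1..n. D m * (\<Sum>k=1..m. y k))" for y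
      unfolding D_def by (subst abel_summation) (simp add: z'_def)
    have part: "(\<Sum>k=1..m. b k) \<le> (\<Sum>k=1..m. w k)" if "m \<in> {1..n}" for m
    proof -
      \<comment> \<open>The positions at which the first m entries of b appear in w; the m entries
        of w there sum to at most the m first ones.\<close>
      let ?A = "inv \<rho> ` {1..m}"
      have inj: "inj (inv \<rho>)" by (rule permutes_inj[OF permutes_inv[OF \<rho>(1)]])
      have sub: "?A \<subseteq> {1..n}" using permutes_image[OF permutes_inv[OF \<rho>(1)]] that by auto
      have "(\<Sum>k=1..m. b k) \<le> (\<Sum>k=1..m. w (inv \<rho> k))"
      proof (intro sum_mono)
        fix k assume "k \<in> {1..m}"
        then have "inv \<rho> k \<in> {1..n}" using sub by blast
        then show "b k \<le> w (inv \<rho> k)" by (simp add: w_def permutes_inverses(1)[OF \<rho>(1)])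
      qed
      also have "\<dots> = (\<Sum>i\<in>?A. w i)"
        using inj by (subst sum.reindex) (auto simp: inj_on_def)
      also have "\<dots> \<le> (\<Sum>k=1..m. w k)"
        using sub inj by (intro sum_subset_le_initial_sum[OF w(1)]) (auto simp: card_image inj_on_def)
      finally show ?thesis .
    qed
    have "(\<Sum>k=1..n. b k * z k) = (\<Sum>k=1..n. z' k * b k)" by (intro sum.cong) (auto simp: z'_def)
    also have "\<dots> \<le> (\<Sum>k=1..n. z' k * w k)"
      unfolding a by (rule sum_mono, rule mult_left_mono) (simp_all only: D part)
    also have "\<dots> = (\<Sum>k=1..n. w k * z k)" by (intro sum.cong) (auto simp: z'_def)
    finally show ?thesis .
  qed
  have conv: "(\<Sum>m=1..n. ennreal (d m) * ennreal (\<Sum>k=1..m. y k)) = ennreal (\<Sum>k=1..n. w k * y k)"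
    if "\<And>i. 0 \<le> y i" for y
    unfolding abel using d that
    by (subst sum_ennreal[symmetric]) (auto intro!: sum.cong mult_nonneg_nonneg sum_nonneg simp: ennreal_mult sum_nonneg)
  show ?thesis
  proof (rule that)
    show "0 \<le> d m" if "m \<in> {1..n}" for m using d[OF that] .
    show "ennreal (N x) \<le> (\<Sum>m=1..n. ennreal (d m) * top_sum n m x)"
    proof -
      have "ennreal (N x) \<le> ennreal (\<Sum>k=1..n. w k * z k)"
        using b(1) zw Nz by (intro ennreal_leI) linarith
      also have "\<dots> = (\<Sum>m=1..n. ennreal (d m) * top_sum n m x)"
        using conv[OF z(2)] tz by (auto intro!: sum.cong)
      finally show ?thesis .
    qed
    fix y :: "nat \<Rightarrow> real"
    obtain \<tau> where \<tau>: "\<tau> permutes {1..n}" "antimono_on {1..n} (\<lambda>i. \<bar>y (\<tau> i)\<bar>)"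
      using exists_sorting_permutation[of n "\<lambda>i. \<bar>y i\<bar>"] by blast
    have ty: "top_sum n m y = ennreal (\<Sum>k=1..m. \<bar>y (\<tau> k)\<bar>)" if "m \<le> n" for m
    proof -
      have "top_sum n m y = top_sum n m (\<lambda>i. \<bar>y (\<tau> i)\<bar>)"
        unfolding top_sum_def exceedances_abs exceedances_permute[OF \<tau>(1)] ..
      then show ?thesis using top_sum_sorted[OF \<tau>(2) _ that] by simp
    qed
    have "(\<Sum>m=1..n. ennreal (d m) * top_sum n m y) = (\<Sum>m=1..n. ennreal (d m) * ennreal (\<Sum>k=1..m. \<bar>y (\<tau> k)\<bar>))"
      using ty by (auto intro!: sum.cong)
    also have "\<dots> = ennreal (\<Sum>k=1..n. w k * \<bar>y (\<tau> k)\<bar>)" by (rule conv) simp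
    also have "\<dots> \<le> ennreal (N (\<lambda>k. \<bar>y (\<tau> k)\<bar>))" by (intro ennreal_leI wN)
    also have "N (\<lambda>k. \<bar>y (\<tau> k)\<bar>) = N y" using N_permute[OF \<tau>(1), of "\<lambda>i. \<bar>y i\<bar>"] by (simp add: N_abs)
    finally show "(\<Sum>m=1..n. ennreal (d m) * top_sum n m y) \<le> ennreal (N y)" .
  qed
qed

end

section \<open>The tail sum and the rearrangement\<close>

definition tail_sum :: "nat \<Rightarrow> 'a measure \<Rightarrow> (nat \<Rightarrow> 'a \<Rightarrow> real) \<Rightarrow> real \<Rightarrow> real" where
  "tail_sum n M f t = (\<Sum>i=1..n. measure M {\<omega>\<in>space M. t < \<bar>f i \<omega>\<bar>})"

lemma less_ennreal_powr_iff:
  assumes "0 < p" "0 \<le> u"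
  shows "ennreal u < ennreal_powr x p \<longleftrightarrow> ennreal (u powr (1 / p)) < x"
proof (cases x)
  case (real r)
  have "u < r powr p \<longleftrightarrow> u powr (1 / p) < r"
  proof
    assume "u < r powr p"
    then have "u powr (1 / p) < (r powr p) powr (1 / p)" using assms by (intro powr_less_mono2) auto
    then show "u powr (1 / p) < r" using assms real by (simp add: powr_powr)
  next
    assume "u powr (1 / p) < r"
    then have "(u powr (1 / p)) powr p < r powr p" using assms by (intro powr_less_mono2) auto
    then show "u < r powr p" using assms by (simp add: powr_powr)
  qed
  then show ?thesis using real assms by (simp add: ennreal_powr_def ennreal_less_iff)
qed (simp add: ennreal_powr_def)

text \<open>Levels are compared in [0, \<infinity>] so that an infinite x is covered: then every
  level counts, and the half-line has infinite measure.\<close>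

lemma layer_cake: "(\<integral>\<^sup>+u\<in>{0..}. indicator {u. ennreal u < x} u \<partial>lborel) = (x :: ennreal)"
proof (cases x)
  case (real r)
  have "(\<integral>\<^sup>+u\<in>{0..}. indicator {u. ennreal u < x} u \<partial>lborel) = (\<integral>\<^sup>+u. indicator {0..<r} u \<partial>lborel)"
    unfolding real(2) using real(1)
    by (intro nn_integral_cong) (simp split: split_indicator add: ennreal_less_iff)
  also have "\<dots> = x" using real by simp
  finally show ?thesis .
next
  case top
  have "(\<integral>\<^sup>+u\<in>{0..}. indicator {u. ennreal u < x} u \<partial>lborel) = (\<integral>\<^sup>+u. indicator {0::real..} u \<partial>lborel)"
    unfolding top by (intro nn_integral_cong) (simp split: split_indicator)
  also have "\<dots> = \<infinity>"
  proof -
    have "ennreal (real k) \<le> emeasure lborel {0::real..}" for k :: nat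
    proof -
      have "ennreal (real k) = emeasure lborel {0..real k}" by simp
      also have "\<dots> \<le> emeasure lborel {0::real..}" by (intro emeasure_mono) auto
      finally show ?thesis .
    qed
    then have "\<not> emeasure lborel {0::real..} < of_nat k" for k
      unfolding ennreal_of_nat_eq_real_of_nat not_less .
    then have "\<not> emeasure lborel {0::real..} < top"
      using ennreal_Ex_less_of_nat by blast
    then show ?thesis using top.not_eq_extremum[of "emeasure lborel {0::real..}"] by simp
  qed
  finally show ?thesis using top by simp
qed

text \<open>
  Cutting at u powr (1/p) avoids the density of t powr p, which has a junk value at t = 0 for p = 1.
\<close>

lemma layer_cake_powr:
  assumes "0 < p"
  shows "(\<integral>\<^sup>+u\<in>{0..}. indicator {u. ennreal (u powr (1 / p)) < x} u \<partial>lborel) = ennreal_powr x p"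
proof -
  have "(\<integral>\<^sup>+u\<in>{0..}. indicator {u. ennreal (u powr (1 / p)) < x} u \<partial>lborel) =
      (\<integral>\<^sup>+u\<in>{0..}. indicator {u. ennreal u < ennreal_powr x p} u \<partial>lborel)"
    using less_ennreal_powr_iff[OF assms] by (intro nn_integral_cong) (auto simp: indicator_def)
  then show ?thesis by (simp only: layer_cake)
qed

section \<open>Quantiles of the tail sum and the distribution of the disjoint sum\<close>

locale independent_family = prob_space M for M :: "'a measure" +
  fixes f :: "nat \<Rightarrow> 'a \<Rightarrow> real" and n :: nat
  assumes n_ge_1: "1 \<le> n" and indep: "indep_vars (\<lambda>_. borel) f {1..n}"
begin

abbreviation S :: "real \<Rightarrow> real" where "S \<equiv> tail_sum n M f"
abbreviation cnt :: "real \<Rightarrow> 'a \<Rightarrow> real" where "cnt t \<omega> \<equiv> exceedances n (\<lambda>i. f i \<omega>) t"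

lemma f_measurable [measurable]: "i \<in> {1..n} \<Longrightarrow> f i \<in> borel_measurable M"
  using indep by (simp add: indep_vars_def)

lemma tail_sum_nonneg [simp]: "0 \<le> S t"
  by (simp add: tail_sum_def sum_nonneg)

lemma tail_sum_antimono: "t \<le> u \<Longrightarrow> S u \<le> S t"
  unfolding tail_sum_def by (intro sum_mono finite_measure_mono) auto

lemma tail_sum_le: "S t \<le> n"
proof -
  have "S t \<le> (\<Sum>i=1..n. 1)" unfolding tail_sum_def by (intro sum_mono prob_le_1)
  then show ?thesis by simp
qed

lemma tail_sum_measurable [measurable]: "S \<in> borel_measurable borel"
proof -
  have "(\<lambda>t. - S t) \<in> borel_measurable borel"
    by (intro borel_measurable_mono monoI) (simp add: tail_sum_antimono)
  then show ?thesis by simp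
qed

text \<open>The tails are defined by a strict inequality, so the events at levels decreasing to t
  increase to the event at t.\<close>

lemma tail_sum_right_continuous:
  assumes "c < S t"
  shows "\<exists>u>t. c < S u"
proof -
  have "(\<lambda>k. measure M {\<omega>\<in>space M. t + 1 / real (Suc k) < \<bar>f i \<omega>\<bar>})
      \<longlonglongrightarrow> measure M {\<omega>\<in>space M. t < \<bar>f i \<omega>\<bar>}" if i: "i \<in> {1..n}" for i
  proof -
    let ?A = "\<lambda>k. {\<omega>\<in>space M. t + 1 / real (Suc k) < \<bar>f i \<omega>\<bar>}"
    have "incseq ?A"
    proof (intro incseq_SucI subsetI)
      fix k \<omega> assume "\<omega> \<in> ?A k"
      moreover have "1 / real (Suc (Suc k)) \<le> 1 / real (Suc k)" by (simp add: field_simps)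
      ultimately show "\<omega> \<in> ?A (Suc k)" by auto
    qed
    then have "(\<lambda>k. measure M (?A k)) \<longlonglongrightarrow> measure M (\<Union>k. ?A k)"
      using i by (intro finite_Lim_measure_incseq) auto
    moreover have "(\<Union>k. ?A k) = {\<omega>\<in>space M. t < \<bar>f i \<omega>\<bar>}"
    proof -
      have "\<exists>k. t + 1 / real (Suc k) < y" if "t < y" for y
      proof -
        have "0 < y - t" using that by simp
        then obtain k where "inverse (real (Suc k)) < y - t" using reals_Archimedean by blast
        then show ?thesis by (intro exI[of _ k]) (simp add: inverse_eq_divide less_diff_eq add.commute)
      qed
      moreover have "t < y" if "t + 1 / real (Suc k) < y" for y k
      proof -
        have "0 < 1 / real (Suc k)" by simp
        then show ?thesis using that by linarith
      qed
      ultimately show ?thesis by blast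
    qed
    ultimately show ?thesis by simp
  qed
  then have "(\<lambda>k. S (t + 1 / real (Suc k))) \<longlonglongrightarrow> S t"
    unfolding tail_sum_def by (rule tendsto_sum)
  then have "eventually (\<lambda>k. c < S (t + 1 / real (Suc k))) sequentially"
    by (rule order_tendstoD) (rule assms)
  then obtain k where "c < S (t + 1 / real (Suc k))" by (auto simp: eventually_sequentially)
  then show ?thesis by (intro exI[of _ "t + 1 / real (Suc k)"]) auto
qed

lemma tail_sum_vanishes:
  assumes "0 < c"
  shows "\<exists>t\<ge>0. S t \<le> c"
proof -
  have "(\<lambda>k. measure M {\<omega>\<in>space M. real k < \<bar>f i \<omega>\<bar>}) \<longlonglongrightarrow> 0" if i: "i \<in> {1..n}" for i
  proof -
    let ?A = "\<lambda>k. {\<omega>\<in>space M. real k < \<bar>f i \<omega>\<bar>}"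
    have "decseq ?A" by (intro decseq_SucI) auto
    then have "(\<lambda>k. measure M (?A k)) \<longlonglongrightarrow> measure M (\<Inter>k. ?A k)"
      using i by (intro finite_Lim_measure_decseq) auto
    moreover have "(\<Inter>k. ?A k) = {}"
    proof -
      have "\<exists>k. \<not> real k < y" for y using real_arch_simple[of y] by (auto simp: not_less)
      then show ?thesis by blast
    qed
    ultimately show ?thesis by simp
  qed
  then have "(\<lambda>k. S (real k)) \<longlonglongrightarrow> (\<Sum>i=1..n. 0)"
    unfolding tail_sum_def by (rule tendsto_sum)
  then have "eventually (\<lambda>k. S (real k) < c) sequentially"
    using assms by (intro order_tendstoD) auto
  then obtain k where "S (real k) < c" by (auto simp: eventually_sequentially)
  then show ?thesis by (intro exI[of _ "real k"]) auto
qed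

text \<open>By right continuity the infimum of the levels with tail sum at most c is itself such a
  level. Having a least one matters: every smaller nonnegative level has tail sum above c.\<close>

lemma tail_sum_quantile:
  assumes "0 < c"
  obtains t where "0 \<le> t" "S t \<le> c" "\<And>u. 0 \<le> u \<Longrightarrow> S u \<le> c \<Longrightarrow> t \<le> u"
proof -
  define A where "A = {t. 0 \<le> t \<and> S t \<le> c}"
  have A: "A \<noteq> {}" "bdd_below A" using tail_sum_vanishes[OF assms] by (auto simp: A_def intro!: bdd_belowI[of _ 0])
  have "S (Inf A) \<le> c"
  proof (rule ccontr)
    assume "\<not> S (Inf A) \<le> c"
    then obtain u where u: "u > Inf A" "c < S u" using tail_sum_right_continuous[of c "Inf A"] by auto
    then obtain t where "t \<in> A" "t < u" using A by (auto simp: cInf_less_iff)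
    then show False using tail_sum_antimono[of t u] u(2) by (auto simp: A_def)
  qed
  moreover have "0 \<le> Inf A" using A(1) by (intro cInf_greatest) (auto simp: A_def)
  moreover have "Inf A \<le> u" if "0 \<le> u" "S u \<le> c" for u
    using that A(2) by (intro cInf_lower) (auto simp: A_def)
  ultimately show ?thesis using that by blast
qed

text \<open>Each f i lives on its own strip of width 1/n, so the level set is a disjoint union of
  rectangles.\<close>

lemma emeasure_disjoint_sum_gt:
  assumes t: "0 \<le> t"
  shows "emeasure (unit_interval_product M) {x\<in>space (unit_interval_product M). t < \<bar>disjoint_sum n f x\<bar>}
    = ennreal (S t / n)"
proof -
  define I where "I i = {(real i - 1) / n ..< real i / n}" for i
  define B where "B i = {\<omega>\<in>space M. t < \<bar>f i \<omega>\<bar>}" for i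
  have n0: "0 < real n" using n_ge_1 by simp
  have I01: "I i \<subseteq> {0..1}" if "i \<in> {1..n}" for i
  proof -
    have "0 \<le> (real i - 1) / n" "real i / n \<le> 1" using that n0 by (auto simp: field_simps)
    then show ?thesis unfolding I_def by auto
  qed
  have disj: "i = j" if "s \<in> I i" "s \<in> I j" for i j s
  proof -
    have "(real i - 1) / n < real j / n" "(real j - 1) / n < real i / n"
      using that by (auto simp: I_def)
    then have "real i - 1 < real j" "real j - 1 < real i"
      using n0 by (simp_all add: divide_less_cancel)
    then show ?thesis by linarith
  qed
  have ds: "disjoint_sum n f (s, \<omega>) = f i \<omega>" if "i \<in> {1..n}" "s \<in> I i" for i s \<omega>
  proof -
    have "indicator (I j) s * f j \<omega> = (if j = i then f j \<omega> else 0)" for j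
      using that(2) disj[of s i j] by (cases "s \<in> I j") auto
    then have "(\<Sum>j=1..n. indicator (I j) s * f j \<omega>) = (\<Sum>j=1..n. if j = i then f j \<omega> else 0)"
      by (intro sum.cong refl)
    also have "\<dots> = f i \<omega>" using that(1) by simp
    finally show ?thesis by (simp add: disjoint_sum_def I_def)
  qed
  \<comment> \<open>The half-open strips miss the point s = 1. There the sum is 0, which never
    exceeds a nonnegative level.\<close>
  have ds0: "disjoint_sum n f (s, \<omega>) = 0" if "\<And>i. i \<in> {1..n} \<Longrightarrow> s \<notin> I i" for s \<omega>
  proof -
    have "(\<Sum>j=1..n. indicator (I j) s * f j \<omega>) = 0" using that by (intro sum.neutral ballI) simp
    then show ?thesis by (simp add: disjoint_sum_def I_def)
  qed
  have "{x\<in>space (unit_interval_product M). t < \<bar>disjoint_sum n f x\<bar>} = (\<Union>i\<in>{1..n}. I i \<times> B i)"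
  proof (intro set_eqI iffI)
    fix x assume x: "x \<in> {x\<in>space (unit_interval_product M). t < \<bar>disjoint_sum n f x\<bar>}"
    obtain s \<omega> where so: "x = (s, \<omega>)" by fastforce
    have "\<exists>i\<in>{1..n}. s \<in> I i"
    proof (rule ccontr)
      assume "\<not> ?thesis"
      then have "disjoint_sum n f (s, \<omega>) = 0" using ds0 by blast
      then show False using x so t by simp
    qed
    then obtain i where "i \<in> {1..n}" "s \<in> I i" by blast
    moreover then have "\<omega> \<in> B i"
      using x ds[of i s \<omega>] by (auto simp: so B_def unit_interval_product_def space_pair_measure)
    ultimately show "x \<in> (\<Union>i\<in>{1..n}. I i \<times> B i)" by (auto simp: so)
  next
    fix x assume "x \<in> (\<Union>i\<in>{1..n}. I i \<times> B i)"
    then obtain i s \<omega> where "i \<in> {1..n}" "x = (s, \<omega>)" "s \<in> I i" "\<omega> \<in> B i" by blast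
    then show "x \<in> {x\<in>space (unit_interval_product M). t < \<bar>disjoint_sum n f x\<bar>}"
      using ds[of i s \<omega>] I01[of i]
      by (auto simp: B_def unit_interval_product_def space_pair_measure space_restrict_space)
  qed
  also have "emeasure (unit_interval_product M) \<dots> = (\<Sum>i=1..n. emeasure (unit_interval_product M) (I i \<times> B i))"
  proof (rule sum_emeasure[symmetric])
    show "(\<lambda>i. I i \<times> B i) ` {1..n} \<subseteq> sets (unit_interval_product M)"
    proof (intro image_subsetI)
      fix i assume i: "i \<in> {1..n}"
      have "I i \<in> sets (restrict_space lborel {0..1})"
        using I01[OF i] by (auto simp: sets_restrict_space_iff I_def)
      moreover have "B i \<in> sets M" using i by (auto simp: B_def)
      ultimately show "I i \<times> B i \<in> sets (unit_interval_product M)"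
        by (auto simp: unit_interval_product_def)
    qed
    show "disjoint_family_on (\<lambda>i. I i \<times> B i) {1..n}"
      unfolding disjoint_family_on_def using disj by blast
  qed simp
  also have "\<dots> = (\<Sum>i=1..n. ennreal (measure M (B i) / n))"
  proof (intro sum.cong refl)
    fix i assume i: "i \<in> {1..n}"
    have I: "I i \<in> sets (restrict_space lborel {0..1})"
      using I01[OF i] by (auto simp: sets_restrict_space_iff I_def)
    have "emeasure (restrict_space lborel {0..1}) (I i) = emeasure lborel (I i)"
      using I01[OF i] by (intro emeasure_restrict_space) auto
    also have "\<dots> = ennreal (1 / n)"
      using n0 by (simp add: I_def divide_right_mono diff_divide_distrib)
    finally have "emeasure (unit_interval_product M) (I i \<times> B i) = ennreal (1 / n) * emeasure M (B i)"
      unfolding unit_interval_product_def using I i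
      by (subst emeasure_pair_measure_Times) (auto simp: B_def)
    then show "emeasure (unit_interval_product M) (I i \<times> B i) = ennreal (measure M (B i) / n)"
      by (simp add: emeasure_eq_measure ennreal_mult'[symmetric])
  qed
  also have "\<dots> = ennreal (S t / n)"
    by (subst sum_ennreal) (auto simp: tail_sum_def B_def sum_divide_distrib)
  finally show ?thesis .
qed

abbreviation hs :: "real \<Rightarrow> ennreal" where
  "hs \<equiv> rearrangement (unit_interval_product M) (disjoint_sum n f)"

lemma rearrangement_eq_Inf:
  fixes s :: real
  assumes s: "0 \<le> s"
  shows "hs s = Inf {ennreal t | t. 0 \<le> t \<and> S t \<le> n * s}"
proof -
  have "emeasure (unit_interval_product M) {x\<in>space (unit_interval_product M). t < \<bar>disjoint_sum n f x\<bar>} \<le> ennreal s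
      \<longleftrightarrow> S t \<le> n * s" if t: "0 \<le> t" for t
  proof -
    have "0 < real n" using n_ge_1 by simp
    then have "S t / n \<le> s \<longleftrightarrow> S t \<le> n * s" by (simp add: pos_divide_le_eq mult.commute)
    then show ?thesis unfolding emeasure_disjoint_sum_gt[OF t] using s by (simp add: ennreal_le_iff)
  qed
  then have "{ennreal t | t. 0 \<le> t \<and> emeasure (unit_interval_product M)
      {x\<in>space (unit_interval_product M). t < \<bar>disjoint_sum n f x\<bar>} \<le> ennreal s} =
      {ennreal t | t. 0 \<le> t \<and> S t \<le> n * s}"
    by blast
  then show ?thesis unfolding rearrangement_def by (rule arg_cong)
qed

text \<open>The rearrangement is the generalized inverse of the tail sum up to the factor n.
  Strictness survives because right continuity gives a level above t whose tail sum still exceeds n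
  s.\<close>

lemma less_rearrangement_iff:
  fixes s t :: real
  assumes s: "0 \<le> s" and t: "0 \<le> t"
  shows "ennreal t < hs s \<longleftrightarrow> n * s < S t"
proof
  assume "ennreal t < hs s"
  show "n * s < S t"
  proof (rule ccontr)
    assume "\<not> n * s < S t"
    then have "hs s \<le> ennreal t"
      unfolding rearrangement_eq_Inf[OF s] using t by (intro Inf_lower) auto
    then show False using \<open>ennreal t < hs s\<close> by simp
  qed
next
  assume "n * s < S t"
  then obtain u where u: "u > t" "n * s < S u" using tail_sum_right_continuous by blast
  have "ennreal u \<le> hs s"
    unfolding rearrangement_eq_Inf[OF s]
  proof (rule Inf_greatest)
    fix x assume "x \<in> {ennreal t | t. 0 \<le> t \<and> S t \<le> n * s}"
    then obtain v where v: "x = ennreal v" "0 \<le> v" "S v \<le> n * s" by blast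
    then have "u \<le> v" using tail_sum_antimono[of v u] u(2) by (cases "u \<le> v") auto
    then show "ennreal u \<le> x" using v(1) by (simp add: ennreal_leI)
  qed
  moreover have "ennreal t < ennreal u" using u t by (simp add: ennreal_less_iff)
  ultimately show "ennreal t < hs s" by simp
qed

text \<open>Fubini for the region under the p-th power of the rearrangement, read along levels
  instead of positions. With a = 0 and b = 1/n it yields the first term of the expression, with
  exponent 1 the blocks of the second.\<close>

lemma rearrangement_integral:
  fixes a b p :: real
  assumes p: "0 < p" and ab: "0 \<le> a" "a \<le> b"
  shows "of_nat n * (\<integral>\<^sup>+s\<in>{a..b}. ennreal_powr (hs s) p \<partial>lborel) =
    (\<integral>\<^sup>+u\<in>{0..}. ennreal (max 0 (min (n * b) (S (u powr (1 / p))) - n * a)) \<partial>lborel)"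
proof -
  have n0: "0 < real n" using n_ge_1 by simp
  let ?A = "{x :: real \<times> real. a \<le> fst x \<and> fst x \<le> b \<and> 0 \<le> snd x \<and> n * fst x < S (snd x powr (1 / p))}"
  have meas: "(indicator ?A :: real \<times> real \<Rightarrow> ennreal) \<in> borel_measurable (lborel \<Otimes>\<^sub>M lborel)"
    by measurable
  have "(\<integral>\<^sup>+s\<in>{a..b}. ennreal_powr (hs s) p \<partial>lborel) = (\<integral>\<^sup>+s. (\<integral>\<^sup>+u. indicator ?A (s, u) \<partial>lborel) \<partial>lborel)"
  proof (intro nn_integral_cong)
    fix s :: real
    show "ennreal_powr (hs s) p * indicator {a..b} s = (\<integral>\<^sup>+u. indicator ?A (s, u) \<partial>lborel)"
    proof (cases "s \<in> {a..b}")
      case True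
      then have "indicator ?A (s, u) = (indicator {u. ennreal (u powr (1 / p)) < hs s} u * indicator {0..} u :: ennreal)" for u
        using ab less_rearrangement_iff[of s "u powr (1 / p)"] by (auto simp: indicator_def)
      then show ?thesis using True layer_cake_powr[OF p, of "hs s"] by simp
    qed (auto simp: indicator_def)
  qed
  also have "\<dots> = (\<integral>\<^sup>+u. (\<integral>\<^sup>+s. indicator ?A (s, u) \<partial>lborel) \<partial>lborel)"
    using meas by (intro lborel_pair.Fubini') simp
  also have "\<dots> = (\<integral>\<^sup>+u\<in>{0..}. ennreal (max 0 (min b (S (u powr (1 / p)) / n) - a)) \<partial>lborel)"
  proof (intro nn_integral_cong)
    fix u :: real
    let ?c = "S (u powr (1 / p)) / n"
    show "(\<integral>\<^sup>+s. indicator ?A (s, u) \<partial>lborel) = ennreal (max 0 (min b ?c - a)) * indicator {0..} u"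
    proof (cases "0 \<le> u")
      case True
      \<comment> \<open>For fixed u the section in s is an interval starting at a, closed at b or
        half-open at \<open>?c\<close>; only its length matters.\<close>
      have iff: "n * s < S (u powr (1 / p)) \<longleftrightarrow> s < ?c" for s :: real using n0 by (simp add: field_simps)
      have "(\<integral>\<^sup>+s. indicator ?A (s, u) \<partial>lborel) = emeasure lborel (if b < ?c then {a..b} else {a..<?c})"
      proof -
        have "indicator ?A (s, u) = (indicator (if b < ?c then {a..b} else {a..<?c}) s :: ennreal)" for s
          using True by (auto simp: iff indicator_def)
        then show ?thesis by simp
      qed
      also have "\<dots> = ennreal (max 0 (min b ?c - a))"
        using ab by (cases "a \<le> ?c") (auto simp: min_def max_def)
      finally show ?thesis using True by simp
    qed (auto simp: indicator_def)
  qed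
  finally have "of_nat n * (\<integral>\<^sup>+s\<in>{a..b}. ennreal_powr (hs s) p \<partial>lborel) =
      (\<integral>\<^sup>+u\<in>{0..}. of_nat n * ennreal (max 0 (min b (S (u powr (1 / p)) / n) - a)) \<partial>lborel)"
    by (simp only:) (subst nn_integral_cmult[symmetric], measurable, simp only: mult.assoc)
  also have "\<dots> = (\<integral>\<^sup>+u\<in>{0..}. ennreal (max 0 (min (n * b) (S (u powr (1 / p))) - n * a)) \<partial>lborel)"
  proof -
    have "of_nat n * ennreal (max 0 (min b (c / n) - a)) = ennreal (max 0 (min (n * b) c - n * a))" for c :: real
    proof -
      have "real n * max 0 (min b (c / n) - a) = max 0 (min (n * b) c - n * a)"
        using n0 by (simp add: max_mult_distrib_left min_mult_distrib_left right_diff_distrib)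
      moreover have "of_nat n * ennreal (max 0 (min b (c / n) - a)) = ennreal (real n * max 0 (min b (c / n) - a))"
        unfolding ennreal_of_nat_eq_real_of_nat by (intro ennreal_mult[symmetric]) auto
      ultimately show ?thesis by simp
    qed
    then show ?thesis by simp
  qed
  finally show ?thesis .
qed

end

section \<open>The lower bound\<close>

lemma ennreal_powr_ennreal: "0 \<le> r \<Longrightarrow> ennreal_powr (ennreal r) a = ennreal (r powr a)"
  by (simp add: ennreal_powr_def)

lemma ennreal_powr_one [simp]: "ennreal_powr x 1 = x"
  by (cases x) (simp_all add: ennreal_powr_def)

lemma ennreal_powr_mono:
  assumes "x \<le> y" "0 \<le> a"
  shows "ennreal_powr x a \<le> ennreal_powr y a"
proof (cases y)
  case (real r)
  then obtain q where q: "x = ennreal q" "0 \<le> q" "q \<le> r"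
    using assms(1) by (cases x) (auto simp: top_unique)
  then show ?thesis using real assms(2) by (simp add: ennreal_powr_ennreal ennreal_leI powr_mono2)
qed (simp add: ennreal_powr_def)

lemma ennreal_powr_cmult:
  assumes "0 < c"
  shows "ennreal_powr (ennreal c * x) a = ennreal (c powr a) * ennreal_powr x a"
proof (cases x)
  case (real r)
  then show ?thesis
    using assms by (simp add: ennreal_mult[symmetric] ennreal_powr_ennreal powr_mult)
next
  case top
  then show ?thesis using assms by (simp add: ennreal_powr_def ennreal_mult_top)
qed

text \<open>Each summand is the length of the part of [0, c] between k - 1 and k, and these slices
  stack up to the capped height. This turns sums of blocks into integrals of capped tail
  sums.\<close>

lemma sum_clamp:
  fixes c :: real
  assumes "0 \<le> c"
  shows "(\<Sum>k=1..m. max 0 (min (real k) c - (real k - 1))) = min (real m) c"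
  using assms by (induction m) auto

text \<open>For every c above the p-th mean, Young's inequality applied to (g/c)^p and 1 gives an
  affine bound of g by g^p that integrates to at most c; then c decreases to the mean. An infinite
  p-th moment is trivial.\<close>

lemma (in prob_space) nn_integral_le_powr_mean:
  assumes g: "g \<in> borel_measurable M" "\<And>\<omega>. 0 \<le> g \<omega>" and p: "1 \<le> p"
  shows "(\<integral>\<^sup>+\<omega>. ennreal (g \<omega>) \<partial>M) \<le> ennreal_powr (\<integral>\<^sup>+\<omega>. ennreal (g \<omega> powr p) \<partial>M) (1 / p)"
proof (cases "\<integral>\<^sup>+\<omega>. ennreal (g \<omega> powr p) \<partial>M")
  case (real j)
  \<comment> \<open>The strict inequality keeps c positive even when the p-th moment vanishes, so
    that division by c is legitimate.\<close>
  have le: "(\<integral>\<^sup>+\<omega>. ennreal (g \<omega>) \<partial>M) \<le> ennreal c" if c: "j powr (1 / p) < c" for c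
  proof -
    have c0: "0 < c" using c powr_ge_zero[of j "1 / p"] by linarith
    have "(j powr (1 / p)) powr p \<le> c powr p" using c p by (intro powr_mono2) auto
    then have jc: "j \<le> c powr p" using p real by (simp add: powr_powr)
    define K where "K = c / (p * c powr p)"
    have K: "0 \<le> K" using c0 p by (simp add: K_def)
    have "g \<omega> \<le> K * g \<omega> powr p + c * (1 - 1 / p)" for \<omega>
    proof (cases "g \<omega> = 0")
      case True
      then show ?thesis using c0 p by simp
    next
      case False
      then have g0: "0 < g \<omega>" using g(2)[of \<omega>] by simp
      have "((g \<omega> / c) powr p) powr (1 / p) * 1 powr (1 - 1 / p) \<le> (1 / p) * (g \<omega> / c) powr p + (1 - 1 / p) * 1"
        using p g0 c0 by (intro Youngs_inequality_0) auto
      then have "g \<omega> / c \<le> (1 / p) * (g \<omega> / c) powr p + (1 - 1 / p)"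
        using p g0 c0 by (simp add: powr_powr)
      then have "c * (g \<omega> / c) \<le> c * ((1 / p) * (g \<omega> / c) powr p + (1 - 1 / p))"
        using c0 by (intro mult_left_mono) auto
      also have "\<dots> = K * g \<omega> powr p + c * (1 - 1 / p)"
        using c0 p g0 by (simp add: K_def powr_divide field_simps)
      finally show ?thesis using c0 by simp
    qed
    then have "(\<integral>\<^sup>+\<omega>. ennreal (g \<omega>) \<partial>M) \<le> (\<integral>\<^sup>+\<omega>. ennreal K * ennreal (g \<omega> powr p) + ennreal (c * (1 - 1 / p)) \<partial>M)"
      using K c0 p by (intro nn_integral_mono) (simp add: ennreal_mult[symmetric] ennreal_plus[symmetric] ennreal_leI del: ennreal_plus)
    also have "\<dots> = ennreal K * ennreal j + ennreal (c * (1 - 1 / p))"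
      using g(1) by (subst nn_integral_add) (auto simp: nn_integral_cmult real emeasure_space_1)
    also have "\<dots> = ennreal (K * j + c * (1 - 1 / p))"
      using K c0 p real by (simp add: ennreal_mult[symmetric] ennreal_plus[symmetric] del: ennreal_plus)
    also have "\<dots> \<le> ennreal (K * c powr p + c * (1 - 1 / p))"
      using jc K by (intro ennreal_leI add_right_mono mult_left_mono) auto
    also have "K * c powr p + c * (1 - 1 / p) = c"
      using c0 p by (simp add: K_def right_diff_distrib)
    finally show ?thesis .
  qed
  obtain i where i: "(\<integral>\<^sup>+\<omega>. ennreal (g \<omega>) \<partial>M) = ennreal i" "0 \<le> i"
    using le[of "j powr (1 / p) + 1"] by (cases "\<integral>\<^sup>+\<omega>. ennreal (g \<omega>) \<partial>M") (auto simp: top_unique)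
  have "i \<le> j powr (1 / p)"
  proof (rule dense_ge)
    fix c assume c: "j powr (1 / p) < c"
    then have "0 < c" using powr_ge_zero[of j "1 / p"] by linarith
    then show "i \<le> c" using le[OF c] by (simp add: i ennreal_le_iff)
  qed
  then show ?thesis using real by (simp add: i ennreal_powr_ennreal ennreal_leI)
qed (simp add: ennreal_powr_def)

section \<open>Continuity and measurability of the norm\<close>

context symmetric_norm
begin

lemma N_diff_le: "\<bar>N x - N y\<bar> \<le> (\<Sum>i=1..n. \<bar>x i - y i\<bar>)"
proof -
  have *: "N x \<le> N y + (\<Sum>i=1..n. \<bar>x i - y i\<bar>)" for x y
  proof -
    have "N x = N (\<lambda>i. y i + (x i - y i))" by simp
    also have "\<dots> \<le> N y + N (\<lambda>i. x i - y i)" by (rule N_triangle)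
    also have "N (\<lambda>i. x i - y i) \<le> (\<Sum>i=1..n. \<bar>x i - y i\<bar>)" by (rule N_le_sum)
    finally show ?thesis by simp
  qed
  show ?thesis using *[of x y] *[of y x] by (simp add: abs_minus_commute)
qed

text \<open>Continuity is meant in the product topology on all sequences: the norm is Lipschitz for
  the sum over finitely many coordinates, which is continuous there.\<close>

lemma N_continuous: "continuous_on UNIV N"
  unfolding continuous_on_def
proof
  fix x :: "nat \<Rightarrow> real"
  have "continuous_on UNIV (\<lambda>y :: nat \<Rightarrow> real. \<Sum>i=1..n. \<bar>y i - x i\<bar>)"
    by (intro continuous_on_sum continuous_on_rabs continuous_on_diff
        continuous_on_product_coordinates continuous_on_const)
  then have "((\<lambda>y. \<Sum>i=1..n. \<bar>y i - x i\<bar>) \<longlongrightarrow> (\<Sum>i=1..n. \<bar>x i - x i\<bar>)) (at x within UNIV)"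
    unfolding continuous_on_def by (rule bspec) simp
  then have lim: "((\<lambda>y. \<Sum>i=1..n. \<bar>y i - x i\<bar>) \<longlongrightarrow> 0) (at x within UNIV)" by simp
  have "((\<lambda>y. N y - N x) \<longlongrightarrow> 0) (at x within UNIV)"
    by (rule Lim_null_comparison[OF _ lim], rule always_eventually) (use N_diff_le in simp)
  then show "(N \<longlongrightarrow> N x) (at x within UNIV)" by (simp only: LIM_zero_iff)
qed

lemma N_measurable:
  assumes "\<And>i. i \<in> {1..n} \<Longrightarrow> g i \<in> borel_measurable M"
  shows "(\<lambda>\<omega>. N (\<lambda>i. g i \<omega>)) \<in> borel_measurable M"
proof -
  \<comment> \<open>Nothing is known about g i outside the index range, so these coordinates are set
    to 0 before measurability into the sequence space is claimed.\<close>
  have "(\<lambda>\<omega> i. if i \<in> {1..n} then g i \<omega> else 0) \<in> borel_measurable M"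
  proof (intro measurable_coordinatewise_then_product)
    show "(\<lambda>\<omega>. if i \<in> {1..n} then g i \<omega> else 0) \<in> borel_measurable M" for i
      using assms[of i] by (cases "i \<in> {1..n}") (simp, simp only: if_False, simp)
  qed
  then have "(\<lambda>\<omega>. N (\<lambda>i. if i \<in> {1..n} then g i \<omega> else 0)) \<in> borel_measurable M"
    using borel_measurable_continuous_onI[OF N_continuous] by (rule measurable_compose)
  moreover have "N (\<lambda>i. if i \<in> {1..n} then g i \<omega> else 0) = N (\<lambda>i. g i \<omega>)" for \<omega>
    by (intro N_cong) simp
  ultimately show ?thesis by simp
qed

end

section \<open>Capped counts against capped tail sums, and the block vector\<close>

context independent_family
begin

lemma cnt_measurable [measurable]: "cnt t \<in> borel_measurable M"
  unfolding exceedances_eq_sum by measurable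

lemma cnt_integrable [simp]: "integrable M (cnt t)" "integrable M (\<lambda>\<omega>. (cnt t \<omega>)\<^sup>2)"
proof -
  show "integrable M (cnt t)"
    by (rule integrable_const_bound[where B = n]) (auto simp: exceedances_le)
  have "(cnt t \<omega>)\<^sup>2 \<le> (real n)\<^sup>2" for \<omega> by (intro power_mono exceedances_le) simp
  then show "integrable M (\<lambda>\<omega>. (cnt t \<omega>)\<^sup>2)"
    by (intro integrable_const_bound[where B = "(real n)\<^sup>2"]) auto
qed

lemma cnt_eq_sum_indicator:
  assumes "\<omega> \<in> space M"
  shows "cnt t \<omega> = (\<Sum>i=1..n. indicator {\<omega>\<in>space M. t < \<bar>f i \<omega>\<bar>} \<omega>)"
  unfolding exceedances_eq_sum using assms by (intro sum.cong refl) (simp split: split_indicator)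

lemma expectation_cnt: "expectation (cnt t) = S t"
proof -
  have "expectation (cnt t) = expectation (\<lambda>\<omega>. \<Sum>i=1..n. indicator {\<omega>\<in>space M. t < \<bar>f i \<omega>\<bar>} \<omega>)"
    by (intro Bochner_Integration.integral_cong refl cnt_eq_sum_indicator)
  also have "\<dots> = S t"
    unfolding tail_sum_def by (subst Bochner_Integration.integral_sum) (auto simp: emeasure_eq_measure)
  finally show ?thesis .
qed

text \<open>Expand the square into pairs of events. Off the diagonal independence factorizes the
  probability; on the diagonal a nonnegative product is added as slack, so that the products sum to
  the full square of S t.\<close>

lemma second_moment_cnt: "expectation (\<lambda>\<omega>. (cnt t \<omega>)\<^sup>2) \<le> S t + (S t)\<^sup>2"
proof -
  define B where "B i = {\<omega>\<in>space M. t < \<bar>f i \<omega>\<bar>}" for i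
  have B_sets: "B i \<in> sets M" if "i \<in> {1..n}" for i using that by (simp add: B_def)
  have S_eq: "S t = (\<Sum>i=1..n. measure M (B i))" by (simp add: tail_sum_def B_def)
  have cnt_eq: "cnt t \<omega> = (\<Sum>i=1..n. indicator (B i) \<omega>)" if "\<omega> \<in> space M" for \<omega>
    using cnt_eq_sum_indicator[OF that] by (simp add: B_def)
  have pair: "measure M (B i \<inter> B j) \<le> (if j = i then measure M (B i) else 0) + measure M (B i) * measure M (B j)"
    if ij: "i \<in> {1..n}" "j \<in> {1..n}" for i j
  proof (cases "i = j")
    case False
    have vim: "f k -` {x. t < \<bar>x\<bar>} \<inter> space M = B k" for k by (auto simp: B_def)
    have "measure M (\<Inter>k\<in>{i, j}. f k -` {x. t < \<bar>x\<bar>} \<inter> space M) =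
        (\<Prod>k\<in>{i, j}. measure M (f k -` {x. t < \<bar>x\<bar>} \<inter> space M))"
      using ij by (intro indep_varsD[OF indep]) auto
    then show ?thesis unfolding vim using False by simp
  qed simp
  have "expectation (\<lambda>\<omega>. (cnt t \<omega>)\<^sup>2) = expectation (\<lambda>\<omega>. \<Sum>i=1..n. \<Sum>j=1..n. indicator (B i \<inter> B j) \<omega>)"
    by (intro Bochner_Integration.integral_cong refl)
      (simp add: cnt_eq power2_eq_square sum_product indicator_inter_arith)
  also have "\<dots> = (\<Sum>i=1..n. \<Sum>j=1..n. measure M (B i \<inter> B j))"
  proof -
    have "integrable M (indicator (B i \<inter> B j) :: _ \<Rightarrow> real)" if "i \<in> {1..n}" "j \<in> {1..n}" for i j
      using that B_sets by (intro integrable_real_indicator) (auto simp: emeasure_eq_measure)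
    moreover have "B i \<inter> B j \<inter> space M = B i \<inter> B j" for i j by (auto simp: B_def)
    ultimately have "expectation (\<lambda>\<omega>. \<Sum>i=1..n. \<Sum>j=1..n. indicator (B i \<inter> B j) \<omega> :: real) =
        (\<Sum>i=1..n. expectation (\<lambda>\<omega>. \<Sum>j=1..n. indicator (B i \<inter> B j) \<omega>))"
      by (intro Bochner_Integration.integral_sum Bochner_Integration.integrable_sum) blast
    also have "\<dots> = (\<Sum>i=1..n. \<Sum>j=1..n. expectation (indicator (B i \<inter> B j)))"
      using \<open>\<And>i j. i \<in> {1..n} \<Longrightarrow> j \<in> {1..n} \<Longrightarrow> integrable M (indicator (B i \<inter> B j))\<close>
      by (intro sum.cong refl Bochner_Integration.integral_sum) blast
    finally show ?thesis by (simp add: \<open>\<And>i j. B i \<inter> B j \<inter> space M = B i \<inter> B j\<close>)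
  qed
  also have "\<dots> \<le> (\<Sum>i=1..n. \<Sum>j=1..n. (if j = i then measure M (B i) else 0) + measure M (B i) * measure M (B j))"
    by (intro sum_mono pair)
  also have "\<dots> = S t + (S t)\<^sup>2"
    by (simp add: sum.distrib S_eq power2_eq_square sum_product)
  finally show ?thesis .
qed

text \<open>The count is first multiplied by a in [0, 1], which only lowers it. The choice a = 1 for
  S t <= m and a = m / S t otherwise brings the mean down to at most m; each of the two
  second-moment terms then costs at most a quarter of the main term.\<close>

lemma min_tail_sum_le_expectation:
  assumes m: "1 \<le> m"
  shows "min m (S t) \<le> 2 * expectation (\<lambda>\<omega>. min m (cnt t \<omega>))"
proof -
  have bound: "a * S t - a\<^sup>2 * (S t + (S t)\<^sup>2) / (4 * m) \<le> expectation (\<lambda>\<omega>. min m (cnt t \<omega>))"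
    if a: "0 \<le> a" "a \<le> 1" for a
  proof -
    have "a * S t - a\<^sup>2 * (S t + (S t)\<^sup>2) / (4 * m) \<le>
        a * expectation (cnt t) - a\<^sup>2 * expectation (\<lambda>\<omega>. (cnt t \<omega>)\<^sup>2) / (4 * m)"
      unfolding expectation_cnt using second_moment_cnt m
      by (intro diff_mono order_refl divide_right_mono mult_left_mono) auto
    also have "\<dots> = expectation (\<lambda>\<omega>. a * cnt t \<omega> - a\<^sup>2 * (cnt t \<omega>)\<^sup>2 / (4 * m))"
      by simp
    also have "\<dots> \<le> expectation (\<lambda>\<omega>. min m (cnt t \<omega>))"
    proof (intro integral_mono)
      show "integrable M (\<lambda>\<omega>. a * cnt t \<omega> - a\<^sup>2 * (cnt t \<omega>)\<^sup>2 / (4 * m))" by simp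
      show "integrable M (\<lambda>\<omega>. min m (cnt t \<omega>))"
        using m by (intro integrable_const_bound[where B = m]) auto
      fix \<omega>
      let ?K = "cnt t \<omega>"
      have "a * ?K \<le> 1 * ?K" using a by (intro mult_right_mono) auto
      moreover have "0 \<le> a\<^sup>2 * ?K\<^sup>2 / (4 * m)" using m by simp
      \<comment> \<open>a quadratic minorant of the minimum, so that two moments of the count suffice\<close>
      moreover have "a * ?K - a\<^sup>2 * ?K\<^sup>2 / (4 * m) \<le> m"
      proof -
        have "0 \<le> (a * ?K - 2 * m)\<^sup>2 / (4 * m)" using m by simp
        also have "\<dots> = m - (a * ?K - a\<^sup>2 * ?K\<^sup>2 / (4 * m))"
          using m by (simp add: power2_eq_square field_simps)
        finally show ?thesis by simp
      qed
      ultimately show "a * ?K - a\<^sup>2 * ?K\<^sup>2 / (4 * m) \<le> min m ?K" by simp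
    qed
    finally show ?thesis .
  qed
  show ?thesis
  proof (cases "S t \<le> m")
    case True
    have "S t / (4 * m) \<le> S t / 4" using m by (intro divide_left_mono) auto
    moreover have "(S t)\<^sup>2 / (4 * m) \<le> S t / 4"
    proof -
      have "S t * S t \<le> S t * m" using True by (intro mult_left_mono) auto
      then show ?thesis using m by (simp add: power2_eq_square field_simps)
    qed
    ultimately show ?thesis using bound[of 1] True by (simp add: add_divide_distrib)
  next
    case False
    then have S: "m < S t" by simp
    have eq: "(m / S t) * S t - (m / S t)\<^sup>2 * (S t + (S t)\<^sup>2) / (4 * m) = m - m / (4 * S t) - m / 4"
      using S m by (simp add: power2_eq_square field_simps)
    have "m / (4 * S t) \<le> m / 4" using S m by (intro divide_left_mono) auto
    then show ?thesis using bound[of "m / S t"] S m unfolding eq by simp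
  qed
qed

lemma ennreal_min_tail_sum_le:
  assumes m: "1 \<le> m"
  shows "ennreal (min m (S t)) \<le> 2 * (\<integral>\<^sup>+\<omega>. ennreal (min m (cnt t \<omega>)) \<partial>M)"
proof -
  have int: "integrable M (\<lambda>\<omega>. min m (cnt t \<omega>))"
    using m by (intro integrable_const_bound[where B = m]) auto
  have "ennreal (min m (S t)) \<le> ennreal (2 * expectation (\<lambda>\<omega>. min m (cnt t \<omega>)))"
    by (intro ennreal_leI min_tail_sum_le_expectation m)
  also have "\<dots> = 2 * (\<integral>\<^sup>+\<omega>. ennreal (min m (cnt t \<omega>)) \<partial>M)"
    using m by (subst nn_integral_eq_integral[OF int]) (auto simp: ennreal_mult')
  finally show ?thesis .
qed

text \<open>The substitution v serves both terms: the p-th root of u for the first and the identity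
  for the blocks.\<close>

lemma integral_min_tail_sum_le:
  fixes v :: "real \<Rightarrow> real"
  assumes m: "1 \<le> m" and v: "v \<in> borel_measurable borel"
  shows "(\<integral>\<^sup>+u\<in>{0..}. ennreal (min m (S (v u))) \<partial>lborel) \<le>
    2 * (\<integral>\<^sup>+\<omega>. (\<integral>\<^sup>+u\<in>{0..}. ennreal (min m (cnt (v u) \<omega>)) \<partial>lborel) \<partial>M)"
proof -
  note measurable_integral = borel_measurable_nn_integral
  interpret pair_sigma_finite lborel M ..
  note v[measurable]
  have [measurable]: "(\<lambda>(u, \<omega>). cnt (v u) \<omega>) \<in> borel_measurable (lborel \<Otimes>\<^sub>M M)"
    unfolding exceedances_eq_sum case_prod_beta by measurable
  have meas: "(\<lambda>(u, \<omega>). ennreal (min m (cnt (v u) \<omega>)) * indicator {0..} u) \<in> borel_measurable (lborel \<Otimes>\<^sub>M M)"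
    unfolding case_prod_beta indicator_def atLeast_iff by measurable
  have "(\<integral>\<^sup>+u\<in>{0..}. ennreal (min m (S (v u))) \<partial>lborel) \<le>
      (\<integral>\<^sup>+u. 2 * (\<integral>\<^sup>+\<omega>. ennreal (min m (cnt (v u) \<omega>)) * indicator {0..} u \<partial>M) \<partial>lborel)"
    using ennreal_min_tail_sum_le[OF m]
    by (intro nn_integral_mono) (simp split: split_indicator)
  also have "\<dots> = 2 * (\<integral>\<^sup>+u. (\<integral>\<^sup>+\<omega>. ennreal (min m (cnt (v u) \<omega>)) * indicator {0..} u \<partial>M) \<partial>lborel)"
    using measurable_integral[OF meas] by (rule nn_integral_cmult)
  also have "\<dots> = 2 * (\<integral>\<^sup>+\<omega>. (\<integral>\<^sup>+u\<in>{0..}. ennreal (min m (cnt (v u) \<omega>)) \<partial>lborel) \<partial>M)"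
    by (subst Fubini'[OF meas]) simp
  finally show ?thesis .
qed

definition block :: "nat \<Rightarrow> ennreal" where
  "block k = of_nat n * (\<integral>\<^sup>+s\<in>{(real k - 1) / n..real k / n}. hs s \<partial>lborel)"

lemma block_eq:
  assumes "1 \<le> k"
  shows "block k = (\<integral>\<^sup>+u\<in>{0..}. ennreal (max 0 (min (real k) (S u) - (real k - 1))) \<partial>lborel)"
proof -
  have n0: "0 < real n" using n_ge_1 by simp
  have "block k = (\<integral>\<^sup>+u\<in>{0..}. ennreal (max 0 (min (n * (real k / n)) (S (u powr (1 / 1))) - n * ((real k - 1) / n))) \<partial>lborel)"
    using rearrangement_integral[of 1 "(real k - 1) / n" "real k / n"] assms
    by (simp add: block_def divide_right_mono)
  also have "\<dots> = (\<integral>\<^sup>+u\<in>{0..}. ennreal (max 0 (min (real k) (S u) - (real k - 1))) \<partial>lborel)"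
    using n0 by (intro nn_integral_cong) (simp split: split_indicator)
  finally show ?thesis .
qed

lemma sum_block: "(\<Sum>k=1..m. block k) = (\<integral>\<^sup>+u\<in>{0..}. ennreal (min (real m) (S u)) \<partial>lborel)"
proof -
  have "(\<Sum>k=1..m. block k) = (\<integral>\<^sup>+u. (\<Sum>k=1..m. ennreal (max 0 (min (real k) (S u) - (real k - 1))) * indicator {0..} u) \<partial>lborel)"
    by (subst nn_integral_sum) (measurable, intro sum.cong refl block_eq, simp)
  also have "\<dots> = (\<integral>\<^sup>+u\<in>{0..}. ennreal (min (real m) (S u)) \<partial>lborel)"
  proof (intro nn_integral_cong)
    fix u
    have "(\<Sum>k=1..m. ennreal (max 0 (min (real k) (S u) - (real k - 1)))) = ennreal (min (real m) (S u))"
      using sum_clamp[OF tail_sum_nonneg] by (subst sum_ennreal) (simp, simp only:)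
    then show "(\<Sum>k=1..m. ennreal (max 0 (min (real k) (S u) - (real k - 1))) * indicator {0..} u) =
        ennreal (min (real m) (S u)) * indicator {0..} u"
      by (simp only: sum_distrib_right[symmetric])
  qed
  finally show ?thesis .
qed

lemma block_antimono:
  assumes "1 \<le> k" "k \<le> l"
  shows "block l \<le> block k"
  using assms unfolding block_eq[OF assms(1)] block_eq[OF order_trans[OF assms]]
  by (intro nn_integral_mono mult_right_mono ennreal_leI) auto

text \<open>The blocks are already decreasing, so their top sums are initial sums. Finiteness makes
  \<open>enn2real\<close> monotone and additive on them.\<close>

lemma top_sum_block:
  assumes fin: "\<And>k. k \<in> {1..n} \<Longrightarrow> block k \<noteq> \<infinity>" and m: "m \<le> n"
  shows "top_sum n m (\<lambda>k. enn2real (block k)) = (\<integral>\<^sup>+u\<in>{0..}. ennreal (min (real m) (S u)) \<partial>lborel)"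
proof -
  have "antimono_on {1..n} (\<lambda>k. enn2real (block k))"
    using fin by (intro monotone_onI enn2real_mono block_antimono) (auto simp: less_top)
  then have "top_sum n m (\<lambda>k. enn2real (block k)) = ennreal (\<Sum>k=1..m. enn2real (block k))"
    using m by (intro top_sum_sorted) auto
  also have "\<dots> = (\<Sum>k=1..m. block k)"
    using fin m by (subst sum_ennreal[symmetric]) (auto intro!: sum.cong ennreal_enn2real simp: less_top)
  finally show ?thesis by (simp only: sum_block)
qed

lemma peak_eq:
  assumes "0 < p"
  shows "of_nat n * (\<integral>\<^sup>+s\<in>{0..1 / real n}. ennreal_powr (hs s) p \<partial>lborel) =
    (\<integral>\<^sup>+u\<in>{0..}. ennreal (min 1 (S (u powr (1 / p)))) \<partial>lborel)"
  using rearrangement_integral[OF assms, of 0 "1 / real n"] n_ge_1 by (simp add: max_def)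

lemma rearrangement_expr_eq:
  "rearrangement_expr p n N M f =
    ennreal_powr (of_nat n * (\<integral>\<^sup>+s\<in>{0..1 / real n}. ennreal_powr (hs s) p \<partial>lborel)) (1 / p) + ennreal_norm n N block"
  unfolding rearrangement_expr_def block_def[abs_def] Let_def ..

end

locale norm_family = independent_family M f n + symmetric_norm n N
  for M :: "'a measure" and f n N
begin

lemma norm_measurable [measurable]: "(\<lambda>\<omega>. N (\<lambda>i. f i \<omega>)) \<in> borel_measurable M"
  by (intro N_measurable f_measurable)

text \<open>With cap 1 the capped count says whether the largest coordinate exceeds the level, and
  the norm dominates every coordinate. The factor 2 under the p-th root is at most 2
  outside.\<close>

lemma peak_le_moment:
  assumes p: "1 \<le> p"
  shows "ennreal_powr (of_nat n * (\<integral>\<^sup>+s\<in>{0..1 / real n}. ennreal_powr (hs s) p \<partial>lborel)) (1 / p)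
    \<le> 2 * moment_of_norm p N M f"
proof -
  have "(\<integral>\<^sup>+u\<in>{0..}. ennreal (min 1 (S (u powr (1 / p)))) \<partial>lborel)
      \<le> 2 * (\<integral>\<^sup>+\<omega>. (\<integral>\<^sup>+u\<in>{0..}. ennreal (min 1 (cnt (u powr (1 / p)) \<omega>)) \<partial>lborel) \<partial>M)"
    by (rule integral_min_tail_sum_le) auto
  also have "\<dots> \<le> 2 * (\<integral>\<^sup>+\<omega>. ennreal (N (\<lambda>i. f i \<omega>) powr p) \<partial>M)"
  proof (intro mult_left_mono nn_integral_mono)
    fix \<omega>
    have "ennreal (min 1 (cnt (u powr (1 / p)) \<omega>)) * indicator {0..} u \<le>
        indicator {0..<N (\<lambda>i. f i \<omega>) powr p} u" for u
    proof (cases "0 \<le> u \<and> cnt (u powr (1 / p)) \<omega> \<noteq> 0")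
      case True
      then obtain i where i: "i \<in> {1..n}" "u powr (1 / p) < \<bar>f i \<omega>\<bar>"
        by (auto simp: exceedances_def card_eq_0_iff)
      then have "u powr (1 / p) < N (\<lambda>i. f i \<omega>)" using coordinate_le_N[OF i(1), of "\<lambda>i. f i \<omega>"] by simp
      then have "(u powr (1 / p)) powr p < N (\<lambda>i. f i \<omega>) powr p" using p by (intro powr_less_mono2) auto
      then have "u < N (\<lambda>i. f i \<omega>) powr p" using True p by (simp add: powr_powr)
      then show ?thesis using True by (simp add: ennreal_le_1)
    qed auto
    then have "(\<integral>\<^sup>+u\<in>{0..}. ennreal (min 1 (cnt (u powr (1 / p)) \<omega>)) \<partial>lborel) \<le>
        (\<integral>\<^sup>+u. indicator {0..<N (\<lambda>i. f i \<omega>) powr p} u \<partial>lborel)"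
      by (intro nn_integral_mono)
    also have "\<dots> = ennreal (N (\<lambda>i. f i \<omega>) powr p)" by simp
    finally show "(\<integral>\<^sup>+u\<in>{0..}. ennreal (min 1 (cnt (u powr (1 / p)) \<omega>)) \<partial>lborel) \<le> ennreal (N (\<lambda>i. f i \<omega>) powr p)" .
  qed auto
  finally have "ennreal_powr (of_nat n * (\<integral>\<^sup>+s\<in>{0..1 / real n}. ennreal_powr (hs s) p \<partial>lborel)) (1 / p)
      \<le> ennreal_powr (ennreal 2 * (\<integral>\<^sup>+\<omega>. ennreal (N (\<lambda>i. f i \<omega>) powr p) \<partial>M)) (1 / p)"
    using p by (subst peak_eq) (auto intro!: ennreal_powr_mono)
  also have "\<dots> = ennreal (2 powr (1 / p)) * moment_of_norm p N M f"
    by (subst ennreal_powr_cmult) (simp_all add: moment_of_norm_def)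
  also have "\<dots> \<le> ennreal 2 * moment_of_norm p N M f"
  proof (intro mult_right_mono ennreal_leI)
    show "2 powr (1 / p) \<le> (2 :: real)" using p powr_mono[of "1 / p" 1 2] by simp
  qed auto
  finally show ?thesis by simp
qed

text \<open>Each top sum of the block vector is at most twice the expected top sum of f. Summation
  with the weights d and the power mean inequality give the claim.\<close>

lemma blocks_le_moment:
  assumes p: "1 \<le> p"
  shows "ennreal_norm n N block \<le> 2 * moment_of_norm p N M f"
proof (cases "moment_of_norm p N M f = \<infinity>")
  case False
  let ?T = "\<lambda>m \<omega>. top_sum n m (\<lambda>i. f i \<omega>)"
  have Tm [measurable]: "?T m \<in> borel_measurable M" for m
  proof -
    have "(\<lambda>(\<omega>, u). ennreal (min (real m) (cnt u \<omega>)) * indicator {0..} u) \<in> borel_measurable (M \<Otimes>\<^sub>M lborel)"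
      unfolding exceedances_eq_sum case_prod_beta by measurable
    then show ?thesis unfolding top_sum_def by (intro lborel.borel_measurable_nn_integral)
  qed
  have EN: "(\<integral>\<^sup>+\<omega>. ennreal (N (\<lambda>i. f i \<omega>)) \<partial>M) \<le> moment_of_norm p N M f"
    unfolding moment_of_norm_def by (rule nn_integral_le_powr_mean[OF _ _ p]) auto
  have X: "(\<integral>\<^sup>+u\<in>{0..}. ennreal (min (real m) (S u)) \<partial>lborel) \<le> 2 * (\<integral>\<^sup>+\<omega>. ?T m \<omega> \<partial>M)" if "1 \<le> m" for m
    unfolding top_sum_def using integral_min_tail_sum_le[of "real m" "\<lambda>u. u"] that by simp
  \<comment> \<open>A finite moment forces finite blocks: their total is at most twice the expected
    sum of all coordinates, which is at most n times the expected norm.\<close>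
  have fin: "block k \<noteq> \<infinity>" if k: "k \<in> {1..n}" for k
  proof -
    have T: "?T n \<omega> \<le> ennreal n * ennreal (N (\<lambda>i. f i \<omega>))" for \<omega>
    proof -
      have "ennreal (min (real n) (cnt u \<omega>)) * indicator {0..} u \<le> ennreal n * indicator {0..<N (\<lambda>i. f i \<omega>)} u" for u
      proof (cases "0 \<le> u \<and> cnt u \<omega> \<noteq> 0")
        case True
        then obtain i where i: "i \<in> {1..n}" "u < \<bar>f i \<omega>\<bar>"
          by (auto simp: exceedances_def card_eq_0_iff)
        then have "u < N (\<lambda>i. f i \<omega>)" using coordinate_le_N[OF i(1), of "\<lambda>i. f i \<omega>"] by simp
        then show ?thesis using True by (simp add: ennreal_leI)
      qed auto
      then have "?T n \<omega> \<le> (\<integral>\<^sup>+u. ennreal n * indicator {0..<N (\<lambda>i. f i \<omega>)} u \<partial>lborel)"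
        unfolding top_sum_def by (intro nn_integral_mono)
      then show ?thesis by (simp add: nn_integral_cmult)
    qed
    have "block k \<le> (\<Sum>k=1..n. block k)" using k by (intro member_le_sum) auto
    also have "\<dots> \<le> 2 * (\<integral>\<^sup>+\<omega>. ?T n \<omega> \<partial>M)" unfolding sum_block using X[OF n_ge_1] .
    also have "\<dots> \<le> 2 * (\<integral>\<^sup>+\<omega>. ennreal n * ennreal (N (\<lambda>i. f i \<omega>)) \<partial>M)"
      using T by (intro mult_left_mono nn_integral_mono) auto
    also have "\<dots> = 2 * (ennreal n * (\<integral>\<^sup>+\<omega>. ennreal (N (\<lambda>i. f i \<omega>)) \<partial>M))" by (simp add: nn_integral_cmult)
    also have "\<dots> \<le> 2 * (ennreal n * moment_of_norm p N M f)" by (intro mult_left_mono EN) auto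
    also have "\<dots> < \<infinity>" using False by (simp add: ennreal_mult_less_top less_top)
    finally show ?thesis by simp
  qed
  let ?x = "\<lambda>k. enn2real (block k)"
  \<comment> \<open>The weights are chosen for the deterministic block vector, so they are constants
    under the expectation below.\<close>
  obtain d where d: "\<And>m. m \<in> {1..n} \<Longrightarrow> 0 \<le> d m"
    "ennreal (N ?x) \<le> (\<Sum>m=1..n. ennreal (d m) * top_sum n m ?x)"
    "\<And>y. (\<Sum>m=1..n. ennreal (d m) * top_sum n m y) \<le> ennreal (N y)"
    using top_sum_representation[of ?x] by blast
  have "ennreal_norm n N block = ennreal (N ?x)" using fin by (auto simp: ennreal_norm_def)
  also have "\<dots> \<le> (\<Sum>m=1..n. ennreal (d m) * top_sum n m ?x)" by (rule d)
  also have "\<dots> \<le> (\<Sum>m=1..n. ennreal (d m) * (2 * (\<integral>\<^sup>+\<omega>. ?T m \<omega> \<partial>M)))"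
    using X top_sum_block[OF fin] by (intro sum_mono mult_left_mono) auto
  also have "\<dots> = 2 * (\<integral>\<^sup>+\<omega>. (\<Sum>m=1..n. ennreal (d m) * ?T m \<omega>) \<partial>M)"
    by (subst nn_integral_sum) (auto simp: nn_integral_cmult sum_distrib_left mult.left_commute)
  also have "\<dots> \<le> 2 * (\<integral>\<^sup>+\<omega>. ennreal (N (\<lambda>i. f i \<omega>)) \<partial>M)"
    by (intro mult_left_mono nn_integral_mono d(3)) auto
  also have "\<dots> \<le> 2 * moment_of_norm p N M f" by (intro mult_left_mono EN) auto
  finally show ?thesis .
qed (simp add: ennreal_mult_top)

lemma lower_bound:
  assumes p: "1 \<le> p"
  shows "ennreal (1 / (2 + 4 * sqrt 2)) * rearrangement_expr p n N M f \<le> moment_of_norm p N M f"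
proof -
  have s: "1 \<le> sqrt 2" by simp
  have "rearrangement_expr p n N M f \<le> 2 * moment_of_norm p N M f + 2 * moment_of_norm p N M f"
    unfolding rearrangement_expr_eq by (intro add_mono peak_le_moment blocks_le_moment p)
  also have "\<dots> = ennreal 4 * moment_of_norm p N M f" by (simp add: distrib_right[symmetric])
  also have "\<dots> \<le> ennreal (2 + 4 * sqrt 2) * moment_of_norm p N M f"
    using s by (intro mult_right_mono ennreal_leI) (linarith, simp)
  finally have "ennreal (1 / (2 + 4 * sqrt 2)) * rearrangement_expr p n N M f \<le>
      ennreal (1 / (2 + 4 * sqrt 2)) * (ennreal (2 + 4 * sqrt 2) * moment_of_norm p N M f)"
    by (intro mult_left_mono) auto
  also have "\<dots> = ennreal (1 / (2 + 4 * sqrt 2) * (2 + 4 * sqrt 2)) * moment_of_norm p N M f"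
    using s by (subst ennreal_mult) (auto simp: mult.assoc)
  also have "1 / (2 + 4 * sqrt 2) * (2 + 4 * sqrt 2) = 1" using s by (intro nonzero_eq_divide_eq[THEN iffD1]) linarith+
  finally show ?thesis by simp
qed

end

section \<open>The upper bound\<close>

text \<open>A rescaled form of y <= exp y. The rate 1 + ln p is, up to a bounded summand, the
  largest whose exponential is still of order p.\<close>

lemma powr_le_exp:
  assumes p: "1 \<le> p" and x: "0 \<le> (x :: real)"
  shows "x powr p \<le> (p / (1 + ln p)) powr p * exp ((1 + ln p) * x)"
proof -
  define l where "l = 1 + ln p"
  have l: "1 \<le> l" using p by (simp add: l_def)
  have "l * x / p \<le> exp (l * x / p)" using exp_ge_add_one_self[of "l * x / p"] by linarith
  then have "(p / l) * (l * x / p) \<le> (p / l) * exp (l * x / p)" using p l by (intro mult_left_mono) auto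
  then have "x \<le> (p / l) * exp (l * x / p)" using p l by simp
  then have "x powr p \<le> ((p / l) * exp (l * x / p)) powr p" using x p by (intro powr_mono2) auto
  also have "\<dots> = (p / l) powr p * exp (l * x / p) powr p"
    by (rule powr_mult)
  also have "exp (l * x / p) powr p = exp (l * x)" using p by (simp add: exp_powr_real)
  finally show ?thesis by (simp add: l_def)
qed

lemma ln_bounds:
  assumes "1 \<le> (p :: real)"
  shows "1 + ln p \<le> p" "1 \<le> p / (1 + ln p)" "exp (1 + ln p) \<le> 3 * p" "exp (2 + ln p) \<le> 9 * p"
proof -
  show 1: "1 + ln p \<le> p" using ln_le_minus_one[of p] assms by simp
  have l: "1 \<le> 1 + ln p" using assms by simp
  then show "1 \<le> p / (1 + ln p)" using 1 by (simp add: le_divide_eq)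
  have e: "exp (1::real) \<le> 3" by (rule exp_le)
  show "exp (1 + ln p) \<le> 3 * p" using assms e by (simp add: exp_add)
  have "exp (2::real) = exp 1 * exp 1" by (simp add: exp_add[symmetric])
  also have "\<dots> \<le> 3 * 3" using e by (intro mult_mono) auto
  finally show "exp (2 + ln p) \<le> 9 * p" using assms by (simp add: exp_add)
qed

lemma powr_add_le:
  assumes "0 \<le> a" "0 \<le> b" "0 \<le> p"
  shows "(a + b) powr p \<le> 2 powr p * (a powr p + b powr (p::real))"
proof -
  have "(a + b) powr p \<le> (2 * max a b) powr p" using assms by (intro powr_mono2) auto
  also have "\<dots> = 2 powr p * (max a b) powr p" using assms by (simp add: powr_mult)
  also have "\<dots> \<le> 2 powr p * (a powr p + b powr p)"
    by (intro mult_left_mono) (auto simp: max_def)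
  finally show ?thesis .
qed

text \<open>Convexity of exp between 0 and l. It separates a part linear in c, with slope e - 1,
  from a part independent of c, which is what makes the moments at level 2^j summable in j.\<close>

lemma exp_one_plus_fraction_le:
  assumes c: "1 \<le> (c :: real)" and l: "0 \<le> l"
  shows "c * (exp (1 + l / c) - 1) \<le> c * (exp 1 - 1) + exp (1 + l)"
proof -
  have "exp ((1 - 1 / c) *\<^sub>R 0 + (1 / c) *\<^sub>R l) \<le> (1 - 1 / c) * exp 0 + (1 / c) * exp l"
    using c by (intro convex_onD[OF exp_convex]) auto
  then have "c * exp (l / c) \<le> c * ((1 - 1 / c) + exp l / c)"
    using c by (intro mult_left_mono) auto
  also have "\<dots> = c + exp l - 1" using c by (simp add: field_simps)
  finally have "exp 1 * (c * exp (l / c)) \<le> exp 1 * (c + exp l - 1)" by simp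
  also have "\<dots> \<le> exp 1 * (c + exp l)" by simp
  finally show ?thesis by (simp add: exp_add algebra_simps)
qed

lemma sum_exp_neg_power2_le: "(\<Sum>j=1..m. exp (- ((2::real) ^ j))) \<le> 1"
proof -
  have "(\<Sum>j=1..m. exp (- ((2::real) ^ j))) \<le> (\<Sum>j=1..m. (1 / 2) ^ j)"
  proof (intro sum_mono)
    fix j :: nat
    have "(2::real) ^ j \<le> exp (2 ^ j)" using exp_ge_add_one_self[of "(2::real) ^ j"] by linarith
    then show "exp (- ((2::real) ^ j)) \<le> (1 / 2) ^ j" by (simp add: exp_minus field_simps)
  qed
  also have "\<dots> = 1 - (1 / 2) ^ m" by (induction m) simp_all
  also have "\<dots> \<le> 1" by simp
  finally show ?thesis .
qed

text \<open>The sum is at most the number of nonzero terms times the largest one. Little is lost for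
  the large parts, whose expected number is at most 1.\<close>

lemma sum_powr_le:
  fixes a :: "nat \<Rightarrow> real"
  assumes p: "0 \<le> p" and a: "\<And>i. 0 \<le> a i"
  shows "(\<Sum>i=1..n. a i) powr p \<le> real (card {i\<in>{1..n}. a i \<noteq> 0}) powr p * (\<Sum>i=1..n. a i powr p)"
proof (cases "{i\<in>{1..n}. a i \<noteq> 0} = {}")
  case True
  then have "(\<Sum>i=1..n. a i) = 0" by (intro sum.neutral) auto
  then show ?thesis by (simp add: sum_nonneg)
next
  case False
  let ?B = "{i\<in>{1..n}. a i \<noteq> 0}"
  define A where "A = Max (a ` ?B)"
  have "A \<in> a ` ?B" unfolding A_def using False by (intro Max_in) auto
  then obtain i where i: "i \<in> {1..n}" "A = a i" by auto
  have "(\<Sum>i=1..n. a i) = (\<Sum>i\<in>?B. a i)" by (intro sum.mono_neutral_right) auto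
  also have "\<dots> \<le> of_nat (card ?B) * A"
    unfolding A_def by (intro sum_bounded_above Max_ge) auto
  finally have "(\<Sum>i=1..n. a i) powr p \<le> (real (card ?B) * A) powr p"
    using p a by (intro powr_mono2) (auto intro: sum_nonneg)
  also have "\<dots> = real (card ?B) powr p * A powr p" using a i by (simp add: powr_mult)
  also have "\<dots> \<le> real (card ?B) powr p * (\<Sum>i=1..n. a i powr p)"
    unfolding i(2) using i(1) by (intro mult_left_mono member_le_sum) auto
  finally show ?thesis .
qed

section \<open>Exponential moments of counts and the large parts\<close>

context independent_family
begin

text \<open>Both the exponential and the weight factor over the independent f j. For j other than i,
  1 + y <= exp y gives the Poisson bound; at j = i the exponential and the weight depend on the same
  variable, so the former is bounded by its maximum exp \<theta>.\<close>

lemma weighted_exp_moment_cnt: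
  assumes g: "g \<in> borel_measurable borel" and i: "i \<in> {1..n}" and \<theta>: "0 \<le> \<theta>"
  shows "(\<integral>\<^sup>+\<omega>. ennreal (exp (\<theta> * cnt t \<omega>)) * g (f i \<omega>) \<partial>M) \<le>
    ennreal (exp (\<theta> + S t * (exp \<theta> - 1))) * (\<integral>\<^sup>+\<omega>. g (f i \<omega>) \<partial>M)"
proof -
  define q where "q j = measure M {\<omega>\<in>space M. t < \<bar>f j \<omega>\<bar>}" for j
  define e where "e x = ennreal (if t < \<bar>x\<bar> then exp \<theta> else 1)" for x :: real
  define X where "X j x = e x * (if j = i then g x else 1)" for j x
  note g[measurable]
  have e_meas [measurable]: "e \<in> borel_measurable borel" unfolding e_def by measurable
  have X_meas: "X j \<in> borel_measurable borel" for j unfolding X_def by (cases "j = i") simp_all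
  have prod_eq: "ennreal (exp (\<theta> * cnt t \<omega>)) * g (f i \<omega>) = (\<Prod>j=1..n. X j (f j \<omega>))" for \<omega>
  proof -
    have "exp (\<theta> * cnt t \<omega>) = (\<Prod>j=1..n. if t < \<bar>f j \<omega>\<bar> then exp \<theta> else 1)"
      unfolding exceedances_eq_sum sum_distrib_left by (subst exp_sum) (auto intro!: prod.cong)
    then have "ennreal (exp (\<theta> * cnt t \<omega>)) = (\<Prod>j=1..n. e (f j \<omega>))"
      unfolding e_def by (simp only:) (rule prod_ennreal[symmetric], simp)
    moreover have "(\<Prod>j=1..n. if j = i then g (f j \<omega>) else 1) = g (f i \<omega>)"
      using i by (simp add: prod.delta)
    ultimately show ?thesis by (simp only: X_def prod.distrib)
  qed
  have "(\<integral>\<^sup>+\<omega>. ennreal (exp (\<theta> * cnt t \<omega>)) * g (f i \<omega>) \<partial>M) = (\<Prod>j=1..n. \<integral>\<^sup>+\<omega>. X j (f j \<omega>) \<partial>M)"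
    unfolding prod_eq by (intro indep_vars_nn_integral indep_vars_compose2[OF indep] X_meas) auto
  also have "\<dots> \<le> (\<Prod>j=1..n. ennreal (exp (q j * (exp \<theta> - 1))) *
      (if j = i then ennreal (exp \<theta>) * (\<integral>\<^sup>+\<omega>. g (f i \<omega>) \<partial>M) else 1))"
  proof (rule prod_mono_ennreal)
    fix j assume j: "j \<in> {1..n}"
    show "(\<integral>\<^sup>+\<omega>. X j (f j \<omega>) \<partial>M) \<le> ennreal (exp (q j * (exp \<theta> - 1))) *
      (if j = i then ennreal (exp \<theta>) * (\<integral>\<^sup>+\<omega>. g (f i \<omega>) \<partial>M) else 1)"
    proof (cases "j = i")
      case True
      have "(\<integral>\<^sup>+\<omega>. X j (f j \<omega>) \<partial>M) \<le> (\<integral>\<^sup>+\<omega>. ennreal (exp \<theta>) * g (f i \<omega>) \<partial>M)"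
      proof (intro nn_integral_mono)
        fix \<omega>
        have "e (f i \<omega>) \<le> ennreal (exp \<theta>)" using \<theta> by (simp add: e_def)
        then show "X j (f j \<omega>) \<le> ennreal (exp \<theta>) * g (f i \<omega>)"
          using True by (simp add: X_def mult_right_mono)
      qed
      also have "\<dots> = ennreal (exp \<theta>) * (\<integral>\<^sup>+\<omega>. g (f i \<omega>) \<partial>M)"
        using measurable_compose[OF f_measurable[OF i] g] by (rule nn_integral_cmult)
      \<comment> \<open>This factor is at least 1 and is inserted at j = i only to complete the
        exponents to the full tail sum.\<close>
      also have "\<dots> \<le> ennreal (exp (q j * (exp \<theta> - 1))) * \<dots>"
      proof -
        have "1 \<le> ennreal (exp (q j * (exp \<theta> - 1)))"
          using \<theta> by (simp add: q_def)
        then show ?thesis using mult_right_mono[of 1 "ennreal (exp (q j * (exp \<theta> - 1)))"] by fastforce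
      qed
      finally show ?thesis using True by simp
    next
      case False
      let ?B = "{\<omega>\<in>space M. t < \<bar>f j \<omega>\<bar>}"
      have B: "?B \<in> sets M" using j by measurable
      have "(\<integral>\<^sup>+\<omega>. X j (f j \<omega>) \<partial>M) = (\<integral>\<^sup>+\<omega>. 1 + ennreal (exp \<theta> - 1) * indicator ?B \<omega> \<partial>M)"
      proof (intro nn_integral_cong)
        fix \<omega> assume "\<omega> \<in> space M"
        moreover have "ennreal (exp \<theta>) = 1 + ennreal (exp \<theta> - 1)"
          using \<theta> by (subst ennreal_1[symmetric], subst ennreal_plus[symmetric]) auto
        ultimately show "X j (f j \<omega>) = 1 + ennreal (exp \<theta> - 1) * indicator ?B \<omega>"
          using False by (simp add: X_def e_def)
      qed
      also have "\<dots> = 1 + ennreal (exp \<theta> - 1) * emeasure M ?B"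
        using B by (subst nn_integral_add) (auto simp: nn_integral_cmult_indicator emeasure_space_1)
      also have "\<dots> = ennreal (1 + q j * (exp \<theta> - 1))"
      proof -
        have "ennreal (1 + q j * (exp \<theta> - 1)) = ennreal 1 + ennreal ((exp \<theta> - 1) * q j)"
          using \<theta> by (subst ennreal_plus) (auto simp: q_def mult.commute)
        also have "ennreal ((exp \<theta> - 1) * q j) = ennreal (exp \<theta> - 1) * emeasure M ?B"
          using \<theta> by (subst ennreal_mult) (auto simp: q_def emeasure_eq_measure)
        finally show ?thesis by simp
      qed
      also have "\<dots> \<le> ennreal (exp (q j * (exp \<theta> - 1)))"
        using exp_ge_add_one_self[of "q j * (exp \<theta> - 1)"] by (intro ennreal_leI) linarith
      finally show ?thesis using False by simp
    qed
  qed
  also have "\<dots> = (\<Prod>j=1..n. ennreal (exp (q j * (exp \<theta> - 1)))) * (ennreal (exp \<theta>) * (\<integral>\<^sup>+\<omega>. g (f i \<omega>) \<partial>M))"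
    using i by (simp add: prod.distrib prod.delta)
  also have "(\<Prod>j=1..n. ennreal (exp (q j * (exp \<theta> - 1)))) = ennreal (exp (S t * (exp \<theta> - 1)))"
    by (subst prod_ennreal) (auto simp: exp_sum[symmetric] tail_sum_def q_def sum_distrib_right)
  also have "ennreal (exp (S t * (exp \<theta> - 1))) * (ennreal (exp \<theta>) * (\<integral>\<^sup>+\<omega>. g (f i \<omega>) \<partial>M)) =
      ennreal (exp (\<theta> + S t * (exp \<theta> - 1))) * (\<integral>\<^sup>+\<omega>. g (f i \<omega>) \<partial>M)"
  proof -
    have "ennreal (exp (S t * (exp \<theta> - 1))) * ennreal (exp \<theta>) = ennreal (exp (\<theta> + S t * (exp \<theta> - 1)))"
      by (subst ennreal_mult[symmetric]) (auto simp: exp_add mult.commute)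
    then show ?thesis by (simp only: mult.assoc[symmetric])
  qed
  finally show ?thesis .
qed

lemma exp_moment_cnt:
  assumes \<theta>: "0 \<le> \<theta>"
  shows "(\<integral>\<^sup>+\<omega>. ennreal (exp (\<theta> * cnt t \<omega>)) \<partial>M) \<le> ennreal (exp (\<theta> + S t * (exp \<theta> - 1)))"
  using weighted_exp_moment_cnt[of "\<lambda>_. 1" 1 \<theta> t] n_ge_1 \<theta> by (simp add: emeasure_space_1)

definition large :: "real \<Rightarrow> nat \<Rightarrow> 'a \<Rightarrow> real" where
  "large t i \<omega> = (if t < \<bar>f i \<omega>\<bar> then f i \<omega> else 0)"

definition small :: "real \<Rightarrow> nat \<Rightarrow> 'a \<Rightarrow> real" where
  "small t i \<omega> = (if t < \<bar>f i \<omega>\<bar> then 0 else f i \<omega>)"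

lemma large_measurable [measurable]: "i \<in> {1..n} \<Longrightarrow> large t i \<in> borel_measurable M"
  unfolding large_def[abs_def] using f_measurable[of i] by measurable

text \<open>By the layer cake formula the left side is the integral of the tail sum at the larger of
  t and the p-th root of u. This is at most S t <= 1 and at most the tail sum at the root.\<close>

lemma sum_large_powr_le:
  assumes p: "1 \<le> p" and t: "0 \<le> t" "S t \<le> 1"
  shows "(\<Sum>i=1..n. \<integral>\<^sup>+\<omega>. ennreal (\<bar>large t i \<omega>\<bar> powr p) \<partial>M) \<le>
    (\<integral>\<^sup>+u\<in>{0..}. ennreal (min 1 (S (u powr (1 / p)))) \<partial>lborel)"
proof -
  let ?B = "\<lambda>i u. {\<omega>\<in>space M. max t (u powr (1 / p)) < \<bar>f i \<omega>\<bar>}"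
  have int: "(\<integral>\<^sup>+\<omega>. ennreal (\<bar>large t i \<omega>\<bar> powr p) \<partial>M) = (\<integral>\<^sup>+u\<in>{0..}. ennreal (measure M (?B i u)) \<partial>lborel)"
    if i: "i \<in> {1..n}" for i
  proof -
    interpret pair_sigma_finite lborel M ..
    note f_measurable[OF i, measurable]
    have meas: "(\<lambda>(u, \<omega>). indicator {x. 0 \<le> fst x \<and> max t (fst x powr (1 / p)) < \<bar>f i (snd x)\<bar>} (u, \<omega>) :: ennreal)
        \<in> borel_measurable (lborel \<Otimes>\<^sub>M M)"
      unfolding indicator_def mem_Collect_eq fst_conv snd_conv case_prod_beta by measurable
    have iff: "(0 \<le> u \<and> u < \<bar>large t i \<omega>\<bar> powr p) \<longleftrightarrow> (0 \<le> u \<and> max t (u powr (1 / p)) < \<bar>f i \<omega>\<bar>)" for u \<omega>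
    proof (cases "0 \<le> u")
      case True
      have "u < x powr p \<longleftrightarrow> u powr (1 / p) < x" if "0 \<le> x" for x
        using less_ennreal_powr_iff[of p u "ennreal x"] p True that
        by (simp add: ennreal_powr_ennreal ennreal_less_iff)
      from this[of "\<bar>large t i \<omega>\<bar>"] show ?thesis
        using True powr_ge_zero[of u "1 / p"] by (auto simp: large_def not_less)
    qed simp
    have "(\<integral>\<^sup>+\<omega>. ennreal (\<bar>large t i \<omega>\<bar> powr p) \<partial>M) =
        (\<integral>\<^sup>+\<omega>. (\<integral>\<^sup>+u. indicator {0..<\<bar>large t i \<omega>\<bar> powr p} u \<partial>lborel) \<partial>M)"
      by simp
    also have "\<dots> = (\<integral>\<^sup>+\<omega>. (\<integral>\<^sup>+u. indicator {x. 0 \<le> fst x \<and> max t (fst x powr (1 / p)) < \<bar>f i (snd x)\<bar>} (u, \<omega>) \<partial>lborel) \<partial>M)"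
      using iff by (intro nn_integral_cong) (simp add: indicator_def)
    also have "\<dots> = (\<integral>\<^sup>+u. (\<integral>\<^sup>+\<omega>. indicator {x. 0 \<le> fst x \<and> max t (fst x powr (1 / p)) < \<bar>f i (snd x)\<bar>} (u, \<omega>) \<partial>M) \<partial>lborel)"
      by (rule Fubini'[OF meas])
    also have "\<dots> = (\<integral>\<^sup>+u\<in>{0..}. ennreal (measure M (?B i u)) \<partial>lborel)"
    proof (intro nn_integral_cong)
      fix u :: real
      have B: "?B i u \<in> sets M" by measurable
      have "(\<integral>\<^sup>+\<omega>. indicator {x. 0 \<le> fst x \<and> max t (fst x powr (1 / p)) < \<bar>f i (snd x)\<bar>} (u, \<omega>) \<partial>M) =
          (\<integral>\<^sup>+\<omega>. indicator {0..} u * indicator (?B i u) \<omega> \<partial>M)"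
        by (intro nn_integral_cong) (simp split: split_indicator)
      also have "\<dots> = indicator {0..} u * emeasure M (?B i u)"
        using B by (rule nn_integral_cmult_indicator)
      finally show "(\<integral>\<^sup>+\<omega>. indicator {x. 0 \<le> fst x \<and> max t (fst x powr (1 / p)) < \<bar>f i (snd x)\<bar>} (u, \<omega>) \<partial>M) =
          ennreal (measure M (?B i u)) * indicator {0..} u"
        by (simp add: emeasure_eq_measure mult.commute)
    qed
    finally show ?thesis .
  qed
  have B_meas: "(\<lambda>u. ennreal (measure M (?B i u)) * indicator {0..} u) \<in> borel_measurable lborel"
    if i: "i \<in> {1..n}" for i
  proof -
    note f_measurable[OF i, measurable]
    have "(\<lambda>(u :: real, \<omega>). if max t (u powr (1 / p)) < \<bar>f i \<omega>\<bar> then 1 else 0 :: ennreal) \<in> borel_measurable (lborel \<Otimes>\<^sub>M M)"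
      by measurable
    then have "(\<lambda>u. \<integral>\<^sup>+\<omega>. (if max t (u powr (1 / p)) < \<bar>f i \<omega>\<bar> then 1 else 0) \<partial>M) \<in> borel_measurable lborel"
      by (rule borel_measurable_nn_integral)
    moreover have "(\<integral>\<^sup>+\<omega>. (if max t (u powr (1 / p)) < \<bar>f i \<omega>\<bar> then 1 else 0) \<partial>M) = ennreal (measure M (?B i u))" for u
    proof -
      have "(\<integral>\<^sup>+\<omega>. (if max t (u powr (1 / p)) < \<bar>f i \<omega>\<bar> then 1 else 0) \<partial>M) = (\<integral>\<^sup>+\<omega>. indicator (?B i u) \<omega> \<partial>M)"
        by (intro nn_integral_cong) (simp split: split_indicator)
      also have "\<dots> = emeasure M (?B i u)" by (intro nn_integral_indicator) measurable
      finally show ?thesis by (simp add: emeasure_eq_measure)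
    qed
    ultimately show ?thesis by simp
  qed
  have "(\<Sum>i=1..n. \<integral>\<^sup>+\<omega>. ennreal (\<bar>large t i \<omega>\<bar> powr p) \<partial>M) =
      (\<integral>\<^sup>+u. (\<Sum>i=1..n. ennreal (measure M (?B i u)) * indicator {0..} u) \<partial>lborel)"
    using int B_meas by (subst nn_integral_sum) (auto intro!: sum.cong)
  also have "\<dots> \<le> (\<integral>\<^sup>+u\<in>{0..}. ennreal (min 1 (S (u powr (1 / p)))) \<partial>lborel)"
  proof (intro nn_integral_mono)
    fix u :: real
    have "(\<Sum>i=1..n. ennreal (measure M (?B i u))) = ennreal (S (max t (u powr (1 / p))))"
      unfolding tail_sum_def by (rule sum_ennreal) simp
    also have "\<dots> \<le> ennreal (min 1 (S (u powr (1 / p))))"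
      using tail_sum_antimono[of t "max t (u powr (1 / p))"] tail_sum_antimono[of "u powr (1 / p)" "max t (u powr (1 / p))"] t
      by (intro ennreal_leI) auto
    finally show "(\<Sum>i=1..n. ennreal (measure M (?B i u)) * indicator {0..} u) \<le>
        ennreal (min 1 (S (u powr (1 / p)))) * indicator {0..} u"
      by (simp only: sum_distrib_right[symmetric]) (rule mult_right_mono, simp_all)
  qed
  finally show ?thesis .
qed

text \<open>The sum to the power p is split into a power of the count and p-th powers of single
  parts. The count is absorbed by an exponential, whose product with each part is handled by
  \<open>weighted_exp_moment_cnt\<close>.\<close>

lemma large_moment_le:
  assumes p: "1 \<le> p" and t: "0 \<le> t" "S t \<le> 1"
  shows "(\<integral>\<^sup>+\<omega>. ennreal ((\<Sum>i=1..n. \<bar>large t i \<omega>\<bar>) powr p) \<partial>M) \<le>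
    ennreal ((p / (1 + ln p)) powr p * exp (4 * p)) *
      (\<integral>\<^sup>+u\<in>{0..}. ennreal (min 1 (S (u powr (1 / p)))) \<partial>lborel)"
proof -
  define l where "l = 1 + ln p"
  define C where "C = (p / l) powr p"
  have l: "1 \<le> l" using p by (simp add: l_def)
  define g where "g x = ennreal (if t < \<bar>x\<bar> then \<bar>x\<bar> powr p else 0)" for x
  have g: "g \<in> borel_measurable borel" unfolding g_def by measurable
  have g_f: "g (f i \<omega>) = ennreal (\<bar>large t i \<omega>\<bar> powr p)" for i \<omega> by (simp add: g_def large_def)
  have pointwise: "ennreal ((\<Sum>i=1..n. \<bar>large t i \<omega>\<bar>) powr p) \<le>
      (\<Sum>i=1..n. ennreal C * (ennreal (exp (l * cnt t \<omega>)) * g (f i \<omega>)))" for \<omega>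
  proof -
    have "{i\<in>{1..n}. \<bar>large t i \<omega>\<bar> \<noteq> 0} = {i\<in>{1..n}. t < \<bar>f i \<omega>\<bar>}"
      using t by (auto simp: large_def)
    then have "(\<Sum>i=1..n. \<bar>large t i \<omega>\<bar>) powr p \<le> cnt t \<omega> powr p * (\<Sum>i=1..n. \<bar>large t i \<omega>\<bar> powr p)"
      using sum_powr_le[of p "\<lambda>i. \<bar>large t i \<omega>\<bar>" n] p by (simp add: exceedances_def)
    also have "\<dots> \<le> (C * exp (l * cnt t \<omega>)) * (\<Sum>i=1..n. \<bar>large t i \<omega>\<bar> powr p)"
      unfolding C_def l_def using p by (intro mult_right_mono powr_le_exp sum_nonneg) auto
    finally have "ennreal ((\<Sum>i=1..n. \<bar>large t i \<omega>\<bar>) powr p) \<le>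
        ennreal ((C * exp (l * cnt t \<omega>)) * (\<Sum>i=1..n. \<bar>large t i \<omega>\<bar> powr p))"
      by (rule ennreal_leI)
    also have "\<dots> = (ennreal C * ennreal (exp (l * cnt t \<omega>))) * (\<Sum>i=1..n. g (f i \<omega>))"
      unfolding g_f by (subst sum_ennreal) (auto simp: ennreal_mult C_def sum_nonneg)
    finally show ?thesis by (simp only: sum_distrib_left mult.assoc)
  qed
  \<comment> \<open>From l <= p, exp l <= 3 p and S t <= 1.\<close>
  have bound: "l + S t * (exp l - 1) \<le> 4 * p"
  proof -
    have "S t * (exp l - 1) \<le> 1 * (exp l - 1)" using t l by (intro mult_right_mono) auto
    then show ?thesis using ln_bounds(1,3)[OF p] by (simp add: l_def)
  qed
  have "(\<integral>\<^sup>+\<omega>. ennreal ((\<Sum>i=1..n. \<bar>large t i \<omega>\<bar>) powr p) \<partial>M) \<le>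
      (\<integral>\<^sup>+\<omega>. (\<Sum>i=1..n. ennreal C * (ennreal (exp (l * cnt t \<omega>)) * g (f i \<omega>))) \<partial>M)"
    by (intro nn_integral_mono pointwise)
  also have "\<dots> = (\<Sum>i=1..n. ennreal C * (\<integral>\<^sup>+\<omega>. ennreal (exp (l * cnt t \<omega>)) * g (f i \<omega>) \<partial>M))"
  proof -
    have m: "(\<lambda>\<omega>. ennreal (exp (l * cnt t \<omega>)) * g (f i \<omega>)) \<in> borel_measurable M" if "i \<in> {1..n}" for i
      using g f_measurable[OF that] by measurable
    then show ?thesis by (subst nn_integral_sum) (auto intro!: sum.cong nn_integral_cmult)
  qed
  also have "\<dots> \<le> (\<Sum>i=1..n. ennreal C * (ennreal (exp (4 * p)) * (\<integral>\<^sup>+\<omega>. g (f i \<omega>) \<partial>M)))"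
  proof (intro sum_mono mult_left_mono)
    fix i assume "i \<in> {1..n}"
    then have "(\<integral>\<^sup>+\<omega>. ennreal (exp (l * cnt t \<omega>)) * g (f i \<omega>) \<partial>M) \<le>
        ennreal (exp (l + S t * (exp l - 1))) * (\<integral>\<^sup>+\<omega>. g (f i \<omega>) \<partial>M)"
      using l by (intro weighted_exp_moment_cnt[OF g]) auto
    also have "\<dots> \<le> ennreal (exp (4 * p)) * (\<integral>\<^sup>+\<omega>. g (f i \<omega>) \<partial>M)"
      using bound by (intro mult_right_mono ennreal_leI) auto
    finally show "(\<integral>\<^sup>+\<omega>. ennreal (exp (l * cnt t \<omega>)) * g (f i \<omega>) \<partial>M) \<le> \<dots>" .
  qed simp
  also have "\<dots> = ennreal (C * exp (4 * p)) * (\<Sum>i=1..n. \<integral>\<^sup>+\<omega>. ennreal (\<bar>large t i \<omega>\<bar> powr p) \<partial>M)"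
    unfolding g_f by (simp add: ennreal_mult C_def sum_distrib_left mult.assoc)
  also have "\<dots> \<le> ennreal (C * exp (4 * p)) * (\<integral>\<^sup>+u\<in>{0..}. ennreal (min 1 (S (u powr (1 / p)))) \<partial>lborel)"
    by (intro mult_left_mono sum_large_powr_le p t) simp
  finally show ?thesis by (simp only: C_def l_def)
qed

end

section \<open>The small parts and the assembly of the upper bound\<close>

context norm_family
begin

text \<open>
  The factor exp (2^j (W j - 3)) in G makes the terms summable over the levels j and exceeds 1 as
  soon as W j > 3, so that no maximal inequality is needed.
\<close>

lemma small_dyadic_bound:
  assumes p: "1 \<le> p"
  obtains t0 R where "0 \<le> t0" "S t0 \<le> 1" "R \<in> borel_measurable M" "\<And>\<omega>. 1 \<le> R \<omega>"
    "\<And>u \<omega>. 0 \<le> u \<Longrightarrow> u < t0 \<Longrightarrow> cnt u \<omega> \<le> R \<omega> * S u"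
    "(\<integral>\<^sup>+\<omega>. ennreal (R \<omega> powr p) \<partial>M) \<le> ennreal ((2 * (p / (1 + ln p))) powr p * exp (12 * p))"
proof -
  define l where "l = 1 + ln p"
  have l: "1 \<le> l" "l \<le> p" using p ln_bounds(1)[OF p] by (simp_all add: l_def)
  have pl: "1 \<le> p / l" using ln_bounds(2)[OF p] by (simp add: l_def)
  have "\<exists>t\<ge>0. S t \<le> 2 ^ j \<and> (\<forall>u\<ge>0. S u \<le> 2 ^ j \<longrightarrow> t \<le> u)" for j :: nat
    using tail_sum_quantile[of "2 ^ j"] by (metis zero_less_numeral zero_less_power)
  \<comment> \<open>Counts decrease in the level, so the count at \<open>\<tau> k\<close> controls
    all levels u at or above \<open>\<tau> k\<close>; comparing with S u costs a factor 2 when S u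
    lies between 2^(k-1) and 2^k. As S <= n <= 2^n, the indices up to n suffice.\<close>
  then obtain \<tau> where \<tau>: "\<And>j. 0 \<le> \<tau> j" "\<And>j. S (\<tau> j) \<le> 2 ^ j" "\<And>j u. 0 \<le> u \<Longrightarrow> S u \<le> 2 ^ j \<Longrightarrow> \<tau> j \<le> u"
    by metis
  define W where "W j \<omega> = cnt (\<tau> j) \<omega> / 2 ^ j" for j \<omega>
  define E where "E j \<omega> = exp (l * W j \<omega> + 2 ^ j * (W j \<omega> - 3))" for j \<omega>
  define G where "G \<omega> = exp (3 * l) + (\<Sum>j=1..n. E j \<omega>)" for \<omega>
  \<comment> \<open>The factor p / l and the p-th root undo \<open>powr_le_exp\<close>; the factor 2
    pays for rounding S u up to a power of 2.\<close>
  define R where "R \<omega> = 2 * ((p / l) * G \<omega> powr (1 / p))" for \<omega>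
  have W_meas [measurable]: "W j \<in> borel_measurable M" for j unfolding W_def[abs_def] by measurable
  have E_meas [measurable]: "E j \<in> borel_measurable M" for j unfolding E_def[abs_def] by measurable
  have G_meas [measurable]: "G \<in> borel_measurable M" unfolding G_def[abs_def] by measurable
  have R_meas: "R \<in> borel_measurable M" unfolding R_def[abs_def] by measurable
  have W_nonneg: "0 \<le> W j \<omega>" for j \<omega> by (simp add: W_def)
  have E_nonneg: "0 \<le> E j \<omega>" for j \<omega> by (simp add: E_def)
  have G1: "1 \<le> G \<omega>" for \<omega>
  proof -
    have "1 \<le> exp (3 * l)" using l by simp
    moreover have "0 \<le> (\<Sum>j=1..n. E j \<omega>)" using E_nonneg by (intro sum_nonneg) auto
    ultimately show ?thesis unfolding G_def by linarith
  qed
  have R1: "1 \<le> R \<omega>" for \<omega>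
  proof -
    have "1 \<le> G \<omega> powr (1 / p)" using G1[of \<omega>] p by (intro ge_one_powr_ge_zero) auto
    then have "1 * 1 \<le> (p / l) * G \<omega> powr (1 / p)" using pl by (intro mult_mono) auto
    then show ?thesis by (simp add: R_def)
  qed
  have expW: "exp (l * W j \<omega>) \<le> G \<omega>" if j: "j \<in> {1..n}" for j \<omega>
  proof (cases "W j \<omega> \<le> 3")
    case True
    then have "exp (l * W j \<omega>) \<le> exp (3 * l)" using l by simp
    also have "\<dots> \<le> G \<omega>" using E_nonneg by (simp add: G_def sum_nonneg)
    finally show ?thesis .
  next
    case False
    then have "exp (l * W j \<omega>) \<le> E j \<omega>" by (simp add: E_def)
    also have "\<dots> \<le> (\<Sum>j=1..n. E j \<omega>)" using j E_nonneg by (intro member_le_sum) auto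
    also have "\<dots> \<le> G \<omega>" by (simp add: G_def)
    finally show ?thesis .
  qed
  have WR: "2 * W j \<omega> \<le> R \<omega>" if j: "j \<in> {1..n}" for j \<omega>
  proof -
    have "W j \<omega> powr p \<le> (p / l) powr p * exp (l * W j \<omega>)"
      unfolding l_def by (rule powr_le_exp[OF p W_nonneg])
    also have "\<dots> \<le> (p / l) powr p * G \<omega>" by (intro mult_left_mono expW j) simp
    also have "\<dots> = ((p / l) * G \<omega> powr (1 / p)) powr p"
      using p G1[of \<omega>] by (subst powr_mult) (simp add: powr_powr)
    finally have "W j \<omega> powr p \<le> ((p / l) * G \<omega> powr (1 / p)) powr p" .
    moreover have "((p / l) * G \<omega> powr (1 / p)) powr p < W j \<omega> powr p" if "(p / l) * G \<omega> powr (1 / p) < W j \<omega>"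
      using that p pl by (intro powr_less_mono2 mult_nonneg_nonneg) auto
    ultimately have "W j \<omega> \<le> (p / l) * G \<omega> powr (1 / p)" by force
    then show ?thesis unfolding R_def by linarith
  qed
  have dom: "cnt u \<omega> \<le> R \<omega> * S u" if u: "0 \<le> u" "u < \<tau> 0" for u \<omega>
  proof -
    \<comment> \<open>Below the least level with tail sum at most 1 the tail sum exceeds 1, so the
      dyadic index k is at least 1.\<close>
    have S1: "1 < S u" using \<tau>(3)[of u 0] u by force
    define k where "k = (LEAST k. S u \<le> 2 ^ k)"
    have Sn: "S u \<le> 2 ^ n"
      using tail_sum_le[of u] less_imp_le[OF of_nat_less_two_power[of n, where 'a=real]] by linarith
    have Sk: "S u \<le> 2 ^ k" unfolding k_def by (rule LeastI[of "\<lambda>k. S u \<le> 2 ^ k", OF Sn])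
    have "k \<le> n" unfolding k_def by (rule Least_le[of "\<lambda>k. S u \<le> 2 ^ k", OF Sn])
    moreover have "k \<noteq> 0" using Sk S1 by (cases k) auto
    ultimately have k: "k \<in> {1..n}" by simp
    have "\<not> S u \<le> 2 ^ (k - 1)" using not_less_Least[of "k - 1" "\<lambda>k. S u \<le> 2 ^ k"] \<open>k \<noteq> 0\<close> by (simp add: k_def)
    then have "2 ^ k \<le> 2 * S u" using \<open>k \<noteq> 0\<close> by (cases k) auto
    have "cnt u \<omega> \<le> cnt (\<tau> k) \<omega>" using \<tau>(3)[OF u(1) Sk] by (rule exceedances_antimono)
    also have "\<dots> = 2 ^ k * W k \<omega>" by (simp add: W_def)
    also have "\<dots> \<le> (2 * S u) * W k \<omega>" using \<open>2 ^ k \<le> 2 * S u\<close> W_nonneg by (rule mult_right_mono)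
    also have "\<dots> = (2 * W k \<omega>) * S u" by simp
    also have "\<dots> \<le> R \<omega> * S u" by (intro mult_right_mono WR k) simp
    finally show ?thesis .
  qed
  have EE: "(\<integral>\<^sup>+\<omega>. ennreal (E j \<omega>) \<partial>M) \<le> ennreal (exp (11 * p) * exp (- (2 ^ j)))" for j
  proof -
    \<comment> \<open>This collects both occurrences of W j in the exponent of E j into one multiple
      of the count.\<close>
    let ?\<theta> = "1 + l / 2 ^ j"
    have eq: "E j \<omega> = exp (- (3 * 2 ^ j)) * exp (?\<theta> * cnt (\<tau> j) \<omega>)" for \<omega>
      unfolding E_def W_def exp_add[symmetric] by (rule arg_cong[of _ _ exp]) (simp add: field_simps)
    have "(\<integral>\<^sup>+\<omega>. ennreal (E j \<omega>) \<partial>M) = ennreal (exp (- (3 * 2 ^ j))) * (\<integral>\<^sup>+\<omega>. ennreal (exp (?\<theta> * cnt (\<tau> j) \<omega>)) \<partial>M)"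
      unfolding eq by (subst nn_integral_cmult[symmetric]) (auto simp: ennreal_mult)
    also have "\<dots> \<le> ennreal (exp (- (3 * 2 ^ j))) * ennreal (exp (?\<theta> + S (\<tau> j) * (exp ?\<theta> - 1)))"
      using l by (intro mult_left_mono exp_moment_cnt) auto
    also have "\<dots> = ennreal (exp (- (3 * 2 ^ j) + (?\<theta> + S (\<tau> j) * (exp ?\<theta> - 1))))"
      by (subst ennreal_mult[symmetric]) (simp_all only: exp_add[symmetric] exp_ge_zero)
    also have "\<dots> \<le> ennreal (exp (11 * p + - (2 ^ j)))"
    proof (intro ennreal_leI exp_le_cancel_iff[THEN iffD2])
      have "S (\<tau> j) * (exp ?\<theta> - 1) \<le> 2 ^ j * (exp ?\<theta> - 1)"
        using \<tau>(2) l by (intro mult_right_mono) auto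
      also have "\<dots> \<le> 2 ^ j * (exp 1 - 1) + exp (1 + l)"
        using l by (intro exp_one_plus_fraction_le) auto
      \<comment> \<open>Since e - 1 <= 2, one full 2^j of the 3 * 2^j subtracted in E j survives and
        provides the decay in j.\<close>
      also have "\<dots> \<le> 2 ^ j * 2 + 9 * p"
        using ln_bounds(4)[OF p] exp_le by (intro add_mono mult_left_mono) (auto simp: l_def)
      finally have "S (\<tau> j) * (exp ?\<theta> - 1) \<le> 2 ^ j * 2 + 9 * p" .
      moreover have "l / 2 ^ j \<le> l / 1" using l by (intro divide_left_mono) auto
      ultimately show "- (3 * 2 ^ j) + (?\<theta> + S (\<tau> j) * (exp ?\<theta> - 1)) \<le> 11 * p + - (2 ^ j)"
        using l p by simp
    qed
    finally show ?thesis by (simp only: exp_add)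
  qed
  have EG: "(\<integral>\<^sup>+\<omega>. ennreal (G \<omega>) \<partial>M) \<le> ennreal (exp (12 * p))"
  proof -
    have "(\<integral>\<^sup>+\<omega>. ennreal (G \<omega>) \<partial>M) = (\<integral>\<^sup>+\<omega>. ennreal (exp (3 * l)) + (\<Sum>j=1..n. ennreal (E j \<omega>)) \<partial>M)"
      unfolding G_def using E_nonneg by (intro nn_integral_cong) (simp add: sum_ennreal sum_nonneg)
    also have "\<dots> = ennreal (exp (3 * l)) + (\<Sum>j=1..n. \<integral>\<^sup>+\<omega>. ennreal (E j \<omega>) \<partial>M)"
      by (subst nn_integral_add) (auto simp: emeasure_space_1 nn_integral_sum)
    also have "\<dots> \<le> ennreal (exp (3 * l)) + (\<Sum>j=1..n. ennreal (exp (11 * p) * exp (- (2 ^ j))))"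
      by (intro add_left_mono sum_mono EE)
    also have "\<dots> = ennreal (exp (3 * l) + exp (11 * p) * (\<Sum>j=1..n. exp (- (2 ^ j))))"
      by (subst sum_ennreal) (auto simp: sum_distrib_left sum_nonneg)
    also have "\<dots> \<le> ennreal (exp (12 * p))"
    proof (intro ennreal_leI)
      have "exp (3 * l) \<le> exp (11 * p)" using l p by simp
      moreover have "exp (11 * p) * (\<Sum>j=1..n. exp (- (2 ^ j))) \<le> exp (11 * p) * 1"
        by (intro mult_left_mono sum_exp_neg_power2_le) simp
      ultimately have "exp (3 * l) + exp (11 * p) * (\<Sum>j=1..n. exp (- (2 ^ j))) \<le> 2 * exp (11 * p)" by linarith
      also have "\<dots> \<le> exp p * exp (11 * p)"
      proof (intro mult_right_mono)
        show "2 \<le> exp p" using exp_ge_add_one_self[of p] p by linarith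
      qed simp
      also have "\<dots> = exp (12 * p)" by (simp add: exp_add[symmetric])
      finally show "exp (3 * l) + exp (11 * p) * (\<Sum>j=1..n. exp (- (2 ^ j))) \<le> exp (12 * p)" .
    qed
    finally show ?thesis .
  qed
  have "(\<integral>\<^sup>+\<omega>. ennreal (R \<omega> powr p) \<partial>M) = (\<integral>\<^sup>+\<omega>. ennreal ((2 * (p / l)) powr p) * ennreal (G \<omega>) \<partial>M)"
  proof (intro nn_integral_cong)
    fix \<omega>
    have "R \<omega> powr p = ((2 * (p / l)) * G \<omega> powr (1 / p)) powr p" unfolding R_def by (simp only: mult.assoc)
    also have "\<dots> = (2 * (p / l)) powr p * (G \<omega> powr (1 / p)) powr p" by (rule powr_mult)
    also have "(G \<omega> powr (1 / p)) powr p = G \<omega>" using p G1[of \<omega>] by (simp add: powr_powr)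
    finally show "ennreal (R \<omega> powr p) = ennreal ((2 * (p / l)) powr p) * ennreal (G \<omega>)"
      using G1[of \<omega>] by (simp add: ennreal_mult)
  qed
  also have "\<dots> = ennreal ((2 * (p / l)) powr p) * (\<integral>\<^sup>+\<omega>. ennreal (G \<omega>) \<partial>M)"
    by (intro nn_integral_cmult) measurable
  also have "\<dots> \<le> ennreal ((2 * (p / l)) powr p) * ennreal (exp (12 * p))"
    by (intro mult_left_mono EG) simp
  also have "\<dots> = ennreal ((2 * (p / l)) powr p * exp (12 * p))" by (simp add: ennreal_mult)
  finally show ?thesis using that[of "\<tau> 0" R] \<tau>(1) \<tau>(2)[of 0] R_meas R1 dom by (simp add: l_def)
qed

text \<open>Small parts never exceed t, so only levels below t matter, where the counts are
  dominated. As R is at least 1, the cap at m is preserved: min m (R S) <= R min m S. The weights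
  may depend on the sample point because the domination holds pointwise.\<close>

lemma N_small_le:
  assumes t: "0 \<le> t" and R: "1 \<le> R" "\<And>u. 0 \<le> u \<Longrightarrow> u < t \<Longrightarrow> cnt u \<omega> \<le> R * S u"
    and fin: "\<And>k. k \<in> {1..n} \<Longrightarrow> block k \<noteq> \<infinity>"
  shows "N (\<lambda>i. small t i \<omega>) \<le> R * N (\<lambda>k. enn2real (block k))"
proof -
  let ?x = "\<lambda>k. enn2real (block k)" and ?s = "\<lambda>i. small t i \<omega>"
  have top: "top_sum n m ?s \<le> ennreal R * top_sum n m ?x" if m: "m \<le> n" for m
  proof -
    have "ennreal (min (real m) (exceedances n ?s u)) * indicator {0..} u \<le>
        ennreal R * (ennreal (min (real m) (S u)) * indicator {0..} u)" for u
    proof (cases "0 \<le> u")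
      case True
      have "min (real m) (exceedances n ?s u) \<le> R * min (real m) (S u)"
      proof (cases "u < t")
        case True
        have "exceedances n ?s u \<le> cnt u \<omega>"
          unfolding exceedances_eq_sum using \<open>0 \<le> u\<close> by (intro sum_mono) (auto simp: small_def)
        also have "\<dots> \<le> R * S u" using \<open>0 \<le> u\<close> True by (rule R)
        finally have "exceedances n ?s u \<le> R * S u" .
        moreover have "1 * real m \<le> R * real m" using R(1) by (intro mult_right_mono) auto
        ultimately show ?thesis using R(1) by (auto simp: min_def)
      next
        case False
        then have "exceedances n ?s u = 0"
          unfolding exceedances_eq_sum using \<open>0 \<le> u\<close> by (intro sum.neutral) (auto simp: small_def)
        then show ?thesis using R(1) by simp
      qed
      then show ?thesis using True R(1) by (simp add: ennreal_mult[symmetric] ennreal_leI)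
    qed simp
    then have "top_sum n m ?s \<le> (\<integral>\<^sup>+u. ennreal R * (ennreal (min (real m) (S u)) * indicator {0..} u) \<partial>lborel)"
      unfolding top_sum_def by (intro nn_integral_mono)
    also have "\<dots> = ennreal R * top_sum n m ?x"
    proof -
      have "top_sum n m ?x = (\<integral>\<^sup>+u\<in>{0..}. ennreal (min (real m) (S u)) \<partial>lborel)"
        by (rule top_sum_block[OF fin m])
      then show ?thesis by (simp only:) (intro nn_integral_cmult, measurable)
    qed
    finally show ?thesis .
  qed
  obtain d where d: "\<And>m. m \<in> {1..n} \<Longrightarrow> 0 \<le> d m"
    "ennreal (N ?s) \<le> (\<Sum>m=1..n. ennreal (d m) * top_sum n m ?s)"
    "\<And>y. (\<Sum>m=1..n. ennreal (d m) * top_sum n m y) \<le> ennreal (N y)"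
    using top_sum_representation[of ?s] by blast
  have "ennreal (N ?s) \<le> (\<Sum>m=1..n. ennreal (d m) * (ennreal R * top_sum n m ?x))"
    using d(2) by (rule order_trans) (intro sum_mono mult_left_mono top, auto)
  also have "\<dots> = ennreal R * (\<Sum>m=1..n. ennreal (d m) * top_sum n m ?x)"
    by (simp add: sum_distrib_left mult.left_commute)
  also have "\<dots> \<le> ennreal R * ennreal (N ?x)" by (intro mult_left_mono d(3)) simp
  also have "\<dots> = ennreal (R * N ?x)" using R(1) by (simp add: ennreal_mult)
  finally show ?thesis using R(1) by (simp add: ennreal_le_iff)
qed

lemma upper_bound:
  assumes p: "1 \<le> p"
  shows "moment_of_norm p N M f \<le> ennreal (8 * exp 12 * p / (1 + ln p)) * rearrangement_expr p n N M f"
proof -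
  define K where "K = p / (1 + ln p)"
  have K: "1 \<le> K" using ln_bounds(2)[OF p] by (simp add: K_def)
  let ?P = "\<integral>\<^sup>+u\<in>{0..}. ennreal (min 1 (S (u powr (1 / p)))) \<partial>lborel"
  have expr: "rearrangement_expr p n N M f = ennreal_powr ?P (1 / p) + ennreal_norm n N block"
    using rearrangement_expr_eq peak_eq[of p] p by simp
  \<comment> \<open>If either term is infinite the right side is infinite, since the constant is
    positive.\<close>
  show ?thesis
  proof (cases "?P = \<infinity> \<or> (\<exists>k\<in>{1..n}. block k = \<infinity>)")
    case True
    then have "rearrangement_expr p n N M f = \<infinity>"
      unfolding expr by (auto simp: ennreal_powr_def ennreal_norm_def)
    moreover have "0 < 8 * exp 12 * p / (1 + ln p)" using K p by (simp add: K_def add_pos_nonneg)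
    ultimately show ?thesis
      using ennreal_mult_top[of "ennreal (8 * exp 12 * p / (1 + ln p))"]
      by (simp only: infinity_ennreal_def ennreal_eq_0_iff not_le top_greatest if_False) simp
  next
    case False
    then have fin: "\<And>k. k \<in> {1..n} \<Longrightarrow> block k \<noteq> \<infinity>" by auto
    obtain P where P: "?P = ennreal P" "0 \<le> P" using False by (cases ?P) auto
    define B where "B = N (\<lambda>k. enn2real (block k))"
    have B: "0 \<le> B" by (simp add: B_def)
    define A where "A = P powr (1 / p)"
    have A: "0 \<le> A" "A powr p = P" using P p by (simp_all add: A_def powr_powr)
    have expr': "rearrangement_expr p n N M f = ennreal (A + B)"
      unfolding expr P(1) using fin P(2) B A by (simp add: ennreal_powr_ennreal ennreal_norm_def A_def B_def ennreal_plus)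
    obtain t R where tR: "0 \<le> t" "S t \<le> 1" "R \<in> borel_measurable M" "\<And>\<omega>. 1 \<le> R \<omega>"
      "\<And>u \<omega>. 0 \<le> u \<Longrightarrow> u < t \<Longrightarrow> cnt u \<omega> \<le> R \<omega> * S u"
      "(\<integral>\<^sup>+\<omega>. ennreal (R \<omega> powr p) \<partial>M) \<le> ennreal ((2 * K) powr p * exp (12 * p))"
      using small_dyadic_bound[OF p] unfolding K_def by blast
    let ?L = "\<lambda>\<omega>. \<Sum>i=1..n. \<bar>large t i \<omega>\<bar>"
    have L_meas: "?L \<in> borel_measurable M" by (intro borel_measurable_sum borel_measurable_abs large_measurable)
    have pointwise: "N (\<lambda>i. f i \<omega>) powr p \<le> (2 powr p * B powr p) * R \<omega> powr p + 2 powr p * ?L \<omega> powr p" for \<omega>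
    proof -
      have "N (\<lambda>i. f i \<omega>) = N (\<lambda>i. small t i \<omega> + large t i \<omega>)"
        by (rule N_cong) (simp add: small_def large_def)
      also have "\<dots> \<le> N (\<lambda>i. small t i \<omega>) + N (\<lambda>i. large t i \<omega>)" by (rule N_triangle)
      also have "\<dots> \<le> R \<omega> * B + ?L \<omega>"
        unfolding B_def using tR fin by (intro add_mono N_small_le N_le_sum) auto
      finally have "N (\<lambda>i. f i \<omega>) powr p \<le> (R \<omega> * B + ?L \<omega>) powr p"
        using p by (intro powr_mono2) auto
      also have "\<dots> \<le> 2 powr p * ((R \<omega> * B) powr p + ?L \<omega> powr p)"
        using tR(4)[of \<omega>] B p by (intro powr_add_le mult_nonneg_nonneg sum_nonneg) auto
      also have "\<dots> = (2 powr p * B powr p) * R \<omega> powr p + 2 powr p * ?L \<omega> powr p"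
        by (simp add: powr_mult algebra_simps)
      finally show ?thesis .
    qed
    have "(\<integral>\<^sup>+\<omega>. ennreal (N (\<lambda>i. f i \<omega>) powr p) \<partial>M) \<le>
        (\<integral>\<^sup>+\<omega>. ennreal (2 powr p * B powr p) * ennreal (R \<omega> powr p) + ennreal (2 powr p) * ennreal (?L \<omega> powr p) \<partial>M)"
    proof (intro nn_integral_mono)
      fix \<omega>
      show "ennreal (N (\<lambda>i. f i \<omega>) powr p) \<le>
          ennreal (2 powr p * B powr p) * ennreal (R \<omega> powr p) + ennreal (2 powr p) * ennreal (?L \<omega> powr p)"
        using ennreal_leI[OF pointwise[of \<omega>]] by (simp add: ennreal_mult ennreal_plus)
    qed
    also have "\<dots> = ennreal (2 powr p * B powr p) * (\<integral>\<^sup>+\<omega>. ennreal (R \<omega> powr p) \<partial>M)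
        + ennreal (2 powr p) * (\<integral>\<^sup>+\<omega>. ennreal (?L \<omega> powr p) \<partial>M)"
    proof -
      have "(\<lambda>\<omega>. ennreal (R \<omega> powr p)) \<in> borel_measurable M" using tR(3) by measurable
      moreover have "(\<lambda>\<omega>. ennreal (?L \<omega> powr p)) \<in> borel_measurable M" using L_meas by measurable
      ultimately show ?thesis by (subst nn_integral_add) (auto simp: nn_integral_cmult)
    qed
    also have "\<dots> \<le> ennreal (2 powr p * B powr p) * ennreal ((2 * K) powr p * exp (12 * p))
        + ennreal (2 powr p) * (ennreal (K powr p * exp (4 * p)) * ennreal P)"
      using tR(6) large_moment_le[OF p tR(1,2)] unfolding P(1) K_def
      by (intro add_mono mult_left_mono) auto
    also have "\<dots> = ennreal (2 powr p * B powr p * ((2 * K) powr p * exp (12 * p)) + 2 powr p * (K powr p * exp (4 * p) * P))"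
      using P(2) by (simp add: ennreal_mult ennreal_plus)
    \<comment> \<open>Origin of 8 exp 12 K: a factor 2 from splitting the power of a sum, 2 K exp 12
      from the moment of R, and another 2 from merging the powers of A and B.\<close>
    also have "\<dots> \<le> ennreal ((8 * exp 12 * K * (A + B)) powr p)"
    proof (intro ennreal_leI)
      have "K powr p * exp (4 * p) * P \<le> (2 * K) powr p * exp (12 * p) * P"
        using K p P(2) by (intro mult_right_mono mult_mono powr_mono2) auto
      then have "2 powr p * B powr p * ((2 * K) powr p * exp (12 * p)) + 2 powr p * (K powr p * exp (4 * p) * P)
          \<le> 2 powr p * B powr p * ((2 * K) powr p * exp (12 * p)) + 2 powr p * ((2 * K) powr p * exp (12 * p) * P)"
        by (intro add_left_mono mult_left_mono) auto
      also have "\<dots> = (2 powr p * (2 * K) powr p * exp (12 * p)) * (A powr p + B powr p)"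
        unfolding A(2) by (simp add: algebra_simps)
      also have "\<dots> \<le> (2 powr p * (2 * K) powr p * exp (12 * p)) * (2 powr p * (A + B) powr p)"
      proof (intro mult_left_mono)
        have "A powr p \<le> (A + B) powr p" "B powr p \<le> (A + B) powr p"
          using A B p by (auto intro!: powr_mono2)
        moreover have "2 * (A + B) powr p \<le> 2 powr p * (A + B) powr p"
          using p powr_mono[of 1 p 2] by (intro mult_right_mono) auto
        ultimately show "A powr p + B powr p \<le> 2 powr p * (A + B) powr p" by linarith
      qed simp
      also have "\<dots> = (8 * exp 12 * K * (A + B)) powr p"
      proof -
        have "exp (12 * p) = exp 12 powr p" by (simp add: exp_powr_real)
        then have "(2 powr p * (2 * K) powr p * exp (12 * p)) * (2 powr p * (A + B) powr p) =
            ((2 * (2 * K) * exp 12) * (2 * (A + B))) powr p"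
          by (simp only: powr_mult)
        also have "(2 * (2 * K) * exp 12) * (2 * (A + B)) = 8 * exp 12 * K * (A + B)" by simp
        finally show ?thesis .
      qed
      finally show "2 powr p * B powr p * ((2 * K) powr p * exp (12 * p)) + 2 powr p * (K powr p * exp (4 * p) * P)
          \<le> (8 * exp 12 * K * (A + B)) powr p" .
    qed
    finally have "moment_of_norm p N M f \<le> ennreal_powr (ennreal ((8 * exp 12 * K * (A + B)) powr p)) (1 / p)"
      unfolding moment_of_norm_def using p by (intro ennreal_powr_mono) auto
    also have "\<dots> = ennreal (8 * exp 12 * K * (A + B))"
      using p K A B by (simp add: ennreal_powr_ennreal powr_powr)
    also have "\<dots> = ennreal (8 * exp 12 * K) * ennreal (A + B)" using K A B by (simp add: ennreal_mult)
    finally show ?thesis unfolding expr' K_def by simp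
  qed
qed

end

section \<open>Transfer to the joint law and optimality\<close>

text \<open>On the right the probability space and the variables occur only through the tail sum.
  This is what permits the passage to the joint law.\<close>

lemma (in norm_family) rearrangement_expr_eq_tail_sum:
  assumes "1 \<le> p"
  shows "rearrangement_expr p n N M f =
    ennreal_powr (\<integral>\<^sup>+u\<in>{0..}. ennreal (min 1 (S (u powr (1 / p)))) \<partial>lborel) (1 / p) +
    ennreal_norm n N (\<lambda>k. \<integral>\<^sup>+u\<in>{0..}. ennreal (max 0 (min (real k) (S u) - (real k - 1))) \<partial>lborel)"
proof -
  have "ennreal_norm n N a = ennreal_norm n N b" if "\<And>k. k \<in> {1..n} \<Longrightarrow> a k = b k" for a b
  proof -
    have "N (\<lambda>i. enn2real (a i)) = N (\<lambda>i. enn2real (b i))" using that by (intro N_cong) simp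
    then show ?thesis using that by (simp add: ennreal_norm_def)
  qed
  from this[of block] show ?thesis
    unfolding rearrangement_expr_eq using assms block_eq by (subst peak_eq) auto
qed

lemma norm_familyI:
  assumes "1 \<le> n" "normalized_symmetric_norm n N" "prob_space M"
    "prob_space.indep_vars M (\<lambda>_. borel) f {1..n}"
  shows "norm_family M f n N"
proof -
  interpret prob_space M by fact
  show ?thesis by unfold_locales (use assms in auto)
qed

section \<open>The joint law on sequences\<close>

context norm_family
begin

definition coordinates :: "'a \<Rightarrow> nat \<Rightarrow> real" where
  "coordinates \<omega> = (\<lambda>i. if i \<in> {1..n} then f i \<omega> else 0)"

definition joint_law :: "(nat \<Rightarrow> real) measure" where
  "joint_law = distr M borel coordinates"

lemma coordinates_measurable [measurable]: "coordinates \<in> borel_measurable M"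
  unfolding coordinates_def[abs_def]
proof (intro measurable_coordinatewise_then_product)
  show "(\<lambda>\<omega>. if i \<in> {1..n} then f i \<omega> else 0) \<in> borel_measurable M" for i
    using f_measurable[of i] by (cases "i \<in> {1..n}") (simp, simp only: if_False, simp)
qed

lemma coordinate_borel [measurable]: "(\<lambda>x :: nat \<Rightarrow> real. x i) \<in> borel_measurable borel"
  by (intro borel_measurable_continuous_onI continuous_on_product_coordinates)

lemma distr_joint_law: "i \<in> {1..n} \<Longrightarrow> distr joint_law borel (\<lambda>x. x i) = distr M borel (f i)"
  unfolding joint_law_def
  by (subst distr_distr[OF coordinate_borel coordinates_measurable])
    (auto simp: coordinates_def intro!: distr_cong)

lemma prob_space_joint_law: "prob_space joint_law"
  unfolding joint_law_def by (intro prob_space_distr coordinates_measurable)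

text \<open>Independence is equivalent to the law of the finite vector being a product. That law and
  its marginals are the same for the f i and for the coordinates under the joint law.\<close>

lemma indep_vars_joint_law: "prob_space.indep_vars joint_law (\<lambda>_. borel) (\<lambda>i x. x i) {1..n}"
proof -
  interpret L: prob_space joint_law by (rule prob_space_joint_law)
  have ne: "{1..n} \<noteq> {}" using n_ge_1 by auto
  have rv: "L.random_variable borel (\<lambda>x. x i)" for i unfolding joint_law_def by simp
  have restr: "(\<lambda>x :: nat \<Rightarrow> real. \<lambda>i\<in>{1..n}. x i) \<in> borel \<rightarrow>\<^sub>M (\<Pi>\<^sub>M i\<in>{1..n}. borel)"
    by (intro measurable_restrict coordinate_borel)
  have "distr joint_law (\<Pi>\<^sub>M i\<in>{1..n}. borel) (\<lambda>x. \<lambda>i\<in>{1..n}. x i) =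
      distr M (\<Pi>\<^sub>M i\<in>{1..n}. borel) (\<lambda>\<omega>. \<lambda>i\<in>{1..n}. f i \<omega>)"
    unfolding joint_law_def
    by (subst distr_distr[OF restr coordinates_measurable])
      (auto simp: coordinates_def o_def restrict_def intro!: distr_cong)
  also have "\<dots> = (\<Pi>\<^sub>M i\<in>{1..n}. distr M borel (f i))"
    using indep_vars_iff_distr_eq_PiM'[OF ne, of f "\<lambda>_. borel"] indep f_measurable by blast
  also have "\<dots> = (\<Pi>\<^sub>M i\<in>{1..n}. distr joint_law borel (\<lambda>x. x i))"
    by (intro PiM_cong refl distr_joint_law[symmetric])
  finally show ?thesis
    using L.indep_vars_iff_distr_eq_PiM'[OF ne, of "\<lambda>i x. x i" "\<lambda>_. borel"] rv by blast
qed

lemma tail_sum_joint_law: "tail_sum n joint_law (\<lambda>i x. x i) = S"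
proof
  fix t
  have "measure joint_law {x\<in>space joint_law. t < \<bar>x i\<bar>} = measure M {\<omega>\<in>space M. t < \<bar>f i \<omega>\<bar>}"
    if i: "i \<in> {1..n}" for i
  proof -
    have "{x :: nat \<Rightarrow> real. t < \<bar>x i\<bar>} \<in> sets borel"
      using measurable_sets[OF coordinate_borel[of i], of "{y. t < \<bar>y\<bar>}"] by (simp add: vimage_def)
    then have "measure joint_law {x\<in>space joint_law. t < \<bar>x i\<bar>} =
        measure M (coordinates -` {x. t < \<bar>x i\<bar>} \<inter> space M)"
      unfolding joint_law_def by (simp add: measure_distr)
    also have "coordinates -` {x. t < \<bar>x i\<bar>} \<inter> space M = {\<omega>\<in>space M. t < \<bar>f i \<omega>\<bar>}"
      using i by (auto simp: coordinates_def)
    finally show ?thesis .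
  qed
  then show "tail_sum n joint_law (\<lambda>i x. x i) t = S t" by (simp add: tail_sum_def)
qed

lemma norm_family_joint_law: "norm_family joint_law (\<lambda>i x. x i) n N"
  using n_ge_1 normalized prob_space_joint_law indep_vars_joint_law by (rule norm_familyI)

lemma moment_joint_law: "moment_of_norm p N joint_law (\<lambda>i x. x i) = moment_of_norm p N M f"
proof -
  have [measurable]: "N \<in> borel_measurable borel"
    by (rule borel_measurable_continuous_onI[OF N_continuous])
  have "(\<integral>\<^sup>+x. ennreal (N x powr p) \<partial>joint_law) = (\<integral>\<^sup>+\<omega>. ennreal (N (coordinates \<omega>) powr p) \<partial>M)"
    unfolding joint_law_def by (subst nn_integral_distr) auto
  moreover have "N (coordinates \<omega>) = N (\<lambda>i. f i \<omega>)" for \<omega>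
    by (rule N_cong) (simp add: coordinates_def)
  ultimately show ?thesis by (simp add: moment_of_norm_def)
qed

text \<open>The coordinates under the joint law form an admissible family on the fixed type, with
  the same moment and the same rearrangement expression.\<close>

lemma moment_le_of_upper_constant:
  assumes C: "upper_constant TYPE(nat \<Rightarrow> real) p C" and p: "1 \<le> p"
  shows "moment_of_norm p N M f \<le> ennreal C * rearrangement_expr p n N M f"
proof -
  have "admissible n N joint_law (\<lambda>i x. x i)"
    unfolding admissible_def using n_ge_1 normalized prob_space_joint_law indep_vars_joint_law by simp
  then have "moment_of_norm p N joint_law (\<lambda>i x. x i) \<le> ennreal C * rearrangement_expr p n N joint_law (\<lambda>i x. x i)"
    using C unfolding upper_constant_def by blast
  also have "rearrangement_expr p n N joint_law (\<lambda>i x. x i) = rearrangement_expr p n N M f"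
    unfolding rearrangement_expr_eq_tail_sum[OF p]
      norm_family.rearrangement_expr_eq_tail_sum[OF norm_family_joint_law p] tail_sum_joint_law ..
  finally show ?thesis by (simp only: moment_joint_law)
qed

end

section \<open>Optimality: Bernoulli variables in the l1 norm\<close>

lemma normalized_symmetric_l1_norm: "normalized_symmetric_norm n (\<lambda>x. \<Sum>i=1..n. \<bar>x i\<bar>)"
proof -
  have "norm_on_Rn n (\<lambda>x. \<Sum>i=1..n. \<bar>x i\<bar>)"
    unfolding norm_on_Rn_def
  proof (intro conjI allI impI)
    fix x y :: "nat \<Rightarrow> real"
    show "(\<Sum>i=1..n. \<bar>x i\<bar>) = (\<Sum>i=1..n. \<bar>y i\<bar>)" if "\<forall>i\<in>{1..n}. x i = y i"
      using that by (intro sum.cong) auto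
    show "(\<Sum>i=1..n. \<bar>x i\<bar>) = 0 \<longleftrightarrow> (\<forall>i\<in>{1..n}. x i = 0)"
      by (subst sum_nonneg_eq_0_iff) auto
    show "(\<Sum>i=1..n. \<bar>x i + y i\<bar>) \<le> (\<Sum>i=1..n. \<bar>x i\<bar>) + (\<Sum>i=1..n. \<bar>y i\<bar>)"
      unfolding sum.distrib[symmetric] by (intro sum_mono abs_triangle_ineq)
  qed (auto simp: abs_mult sum_distrib_left sum_nonneg)
  moreover have "symmetric_unconditional n (\<lambda>x. \<Sum>i=1..n. \<bar>x i\<bar>)"
    unfolding symmetric_unconditional_def
  proof (intro allI impI)
    fix x \<epsilon> :: "nat \<Rightarrow> real" and \<pi>
    assume a: "(\<forall>i\<in>{1..n}. \<epsilon> i \<in> {-1, 1}) \<and> \<pi> permutes {1..n}"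
    then have "\<bar>\<epsilon> i\<bar> = 1" if "i \<in> {1..n}" for i using that by force
    then have "(\<Sum>i=1..n. \<bar>\<epsilon> i * x (\<pi> i)\<bar>) = (\<Sum>i=1..n. \<bar>x (\<pi> i)\<bar>)"
      by (intro sum.cong) (auto simp: abs_mult)
    also have "\<dots> = (\<Sum>i=1..n. \<bar>x i\<bar>)"
      using sum.permute[of \<pi> "{1..n}" "\<lambda>i. \<bar>x i\<bar>"] a by (simp add: o_def)
    finally show "(\<Sum>i=1..n. \<bar>\<epsilon> i * x (\<pi> i)\<bar>) = (\<Sum>i=1..n. \<bar>x i\<bar>)" .
  qed
  moreover have "(\<Sum>j=1..n. \<bar>unit_vector i j\<bar>) = 1" if "i \<in> {1..n}" for i
  proof -
    have "(\<Sum>j=1..n. \<bar>unit_vector i j\<bar>) = (\<Sum>j=1..n. if j = i then 1 else 0)"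
      by (intro sum.cong) (auto simp: unit_vector_def)
    then show ?thesis using that by simp
  qed
  ultimately show ?thesis by (simp add: normalized_symmetric_norm_def)
qed

text \<open>With n variables of mean 1/n the tail sum is the indicator of [0, 1) on nonnegative
  levels, so the block vector is the first unit vector and both terms of the expression equal
  1.\<close>

lemma bernoulli_example:
  assumes n: "1 \<le> n" and p: "1 \<le> p" and C: "upper_constant TYPE(nat \<Rightarrow> real) p C"
  shows "real n * (1 / real n) powr (real n / p) \<le> 2 * C"
proof -
  define N where "N x = (\<Sum>i=1..n. \<bar>x i\<bar>)" for x :: "nat \<Rightarrow> real"
  define Q where "Q = Pi_pmf {1..n} False (\<lambda>_. bernoulli_pmf (1 / real n))"
  define M where "M = measure_pmf Q"
  define f where "f i x = (of_bool (x i) :: real)" for i :: nat and x :: "nat \<Rightarrow> bool"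
  have n01: "1 / real n \<in> {0..1}" using n by auto
  have ind: "prob_space.indep_vars M (\<lambda>_. borel) f {1..n}"
  proof -
    have "prob_space.indep_vars M (\<lambda>_. count_space UNIV) (\<lambda>i x. x i) {1..n}"
      unfolding M_def Q_def by (rule indep_vars_Pi_pmf) simp
    then show ?thesis
      unfolding f_def M_def
      by (rule prob_space.indep_vars_compose2[OF measure_pmf.prob_space_axioms]) simp
  qed
  interpret norm_family M f n N
    using n normalized_symmetric_l1_norm[of n] ind
    by (intro norm_familyI) (simp_all add: N_def[abs_def] M_def measure_pmf.prob_space_axioms)
  have S01: "S t = (if t < 1 then 1 else 0)" if t: "0 \<le> t" for t
  proof -
    have "measure M {x\<in>space M. t < \<bar>f i x\<bar>} = (if t < 1 then 1 / real n else 0)" if i: "i \<in> {1..n}" for i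
    proof -
      have "{x\<in>space M. t < \<bar>f i x\<bar>} = (if t < 1 then (\<lambda>x. x i) -` {True} else {})"
        using t by (auto simp: M_def f_def)
      moreover have "measure M ((\<lambda>x. x i) -` {True}) = 1 / real n"
      proof -
        have "measure M ((\<lambda>x. x i) -` {True}) = measure (map_pmf (\<lambda>x. x i) Q) {True}"
          by (simp add: M_def)
        also have "map_pmf (\<lambda>x. x i) Q = bernoulli_pmf (1 / real n)"
          unfolding Q_def using i by (subst Pi_pmf_component) auto
        finally show ?thesis using n01 by (simp add: measure_pmf_single)
      qed
      ultimately show ?thesis by simp
    qed
    then show ?thesis using n by (simp add: tail_sum_def)
  qed
  have peak: "(\<integral>\<^sup>+u\<in>{0..}. ennreal (min 1 (S (u powr (1 / p)))) \<partial>lborel) = 1"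
  proof -
    have "u powr (1 / p) < 1 \<longleftrightarrow> u < 1" if "0 \<le> u" for u
      using less_ennreal_powr_iff[of p u 1] p that
      by (simp add: ennreal_powr_def ennreal_less_one_iff)
    then have "(\<integral>\<^sup>+u\<in>{0..}. ennreal (min 1 (S (u powr (1 / p)))) \<partial>lborel) = (\<integral>\<^sup>+u. indicator {0..<1::real} u \<partial>lborel)"
      by (intro nn_integral_cong) (simp add: S01 split: split_indicator)
    then show ?thesis by simp
  qed
  have blk: "(\<integral>\<^sup>+u\<in>{0..}. ennreal (max 0 (min (real k) (S u) - (real k - 1))) \<partial>lborel) = (if k = 1 then 1 else 0)"
    if k: "k \<in> {1..n}" for k
  proof (cases "k = 1")
    case True
    have "(\<integral>\<^sup>+u\<in>{0..}. ennreal (max 0 (min (real k) (S u) - (real k - 1))) \<partial>lborel) = (\<integral>\<^sup>+u. indicator {0..<1::real} u \<partial>lborel)"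
      using True by (intro nn_integral_cong) (simp add: S01 split: split_indicator)
    then show ?thesis using True by simp
  next
    case False
    then have k2: "2 \<le> real k" using k by auto
    have "(\<integral>\<^sup>+u\<in>{0..}. ennreal (max 0 (min (real k) (S u) - (real k - 1))) \<partial>lborel) = (\<integral>\<^sup>+u. 0 \<partial>(lborel :: real measure))"
      using k2 by (intro nn_integral_cong) (auto simp: S01 max_def split: split_indicator)
    then show ?thesis using False by simp
  qed
  have "ennreal_norm n N (\<lambda>k. \<integral>\<^sup>+u\<in>{0..}. ennreal (max 0 (min (real k) (S u) - (real k - 1))) \<partial>lborel) = 1"
  proof -
    have "N (\<lambda>k. enn2real (\<integral>\<^sup>+u\<in>{0..}. ennreal (max 0 (min (real k) (S u) - (real k - 1))) \<partial>lborel)) = N (unit_vector 1)"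
      using blk by (intro N_cong) (simp add: unit_vector_def)
    also have "\<dots> = 1" using n by (intro N_unit) simp
    finally show ?thesis using blk by (simp add: ennreal_norm_def)
  qed
  then have expr: "rearrangement_expr p n N M f = 2"
    unfolding rearrangement_expr_eq_tail_sum[OF p] peak by (simp add: ennreal_powr_def)
  \<comment> \<open>At this point all variables are 1: the norm is n and the probability is n^(-n),
    which bounds the moment from below.\<close>
  define z where "z i = (i \<in> {1..n})" for i
  have pz: "pmf Q z = (1 / real n) ^ n"
    unfolding Q_def using n01 by (subst pmf_Pi') (auto simp: z_def)
  have "ennreal (real n powr p * (1 / real n) ^ n) = ennreal (N (\<lambda>i. f i z) powr p) * emeasure M {z}"
    by (simp add: M_def emeasure_pmf_single pz N_def f_def z_def ennreal_mult')
  also have "\<dots> = (\<integral>\<^sup>+x. ennreal (N (\<lambda>i. f i z) powr p) * indicator {z} x \<partial>M)"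
    by (simp add: M_def nn_integral_cmult_indicator)
  also have "\<dots> \<le> (\<integral>\<^sup>+x. ennreal (N (\<lambda>i. f i x) powr p) \<partial>M)"
    by (intro nn_integral_mono) (simp split: split_indicator)
  finally have "ennreal_powr (ennreal (real n powr p * (1 / real n) ^ n)) (1 / p) \<le> moment_of_norm p N M f"
    unfolding moment_of_norm_def using p by (intro ennreal_powr_mono) auto
  also have "\<dots> \<le> ennreal C * 2"
    using moment_le_of_upper_constant[OF C p] by (simp only: expr)
  also have "\<dots> = ennreal (2 * C)"
    by (simp add: ennreal_mult'' mult.commute)
  finally have "ennreal ((real n powr p * (1 / real n) ^ n) powr (1 / p)) \<le> ennreal (2 * C)"
    by (simp add: ennreal_powr_ennreal)
  moreover have "(real n powr p * (1 / real n) ^ n) powr (1 / p) = real n * (1 / real n) powr (real n / p)"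
  proof -
    have "(1 / real n) ^ n = (1 / real n) powr real n" using n by (simp add: powr_realpow)
    then have "(real n powr p * (1 / real n) ^ n) powr (1 / p) =
        (real n powr p) powr (1 / p) * ((1 / real n) powr real n) powr (1 / p)"
      by (simp only: powr_mult)
    then show ?thesis using n p by (simp add: powr_powr)
  qed
  \<comment> \<open>Conversion to [0, \<infinity>] truncates negative reals at 0; positivity of the
    left side excludes a negative C.\<close>
  moreover have "0 < real n * (1 / real n) powr (real n / p)" using n by simp
  ultimately show ?thesis by (simp add: ennreal_le_iff2)
qed

lemma upper_constant_lower_bound:
  assumes p: "1 \<le> p" and C: "upper_constant TYPE(nat \<Rightarrow> real) p C"
  shows "exp (- 1) / 4 * (p / (1 + ln p)) \<le> C"
proof -
  define K where "K = p / (1 + ln p)"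
  have K: "1 \<le> K" using ln_bounds(2)[OF p] by (simp add: K_def)
  \<comment> \<open>This is the largest n of the required order: n ln n <= K ln p <= p keeps
    n^(-n/p) above exp (-1), while n >= K / 2 because K >= 1.\<close>
  define n where "n = nat \<lfloor>K\<rfloor>"
  have n: "1 \<le> n" "real n \<le> K" "K < real n + 1" using K unfolding n_def by linarith+
  have l: "0 < 1 + ln p" using p by (simp add: add_pos_nonneg)
  have "p / (1 + ln p) \<le> p / 1" using l p by (intro divide_left_mono) auto
  then have "K \<le> p" by (simp add: K_def)
  then have lnn: "ln n \<le> ln p" using n p by (subst ln_le_cancel_iff) auto
  have "real n * ln n \<le> K * ln p" using n lnn K p by (intro mult_mono) auto
  also have "\<dots> = p * (ln p / (1 + ln p))" by (simp add: K_def)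
  also have "\<dots> \<le> p * 1" using l p by (intro mult_left_mono) (simp_all add: divide_le_eq)
  finally have "real n * ln n \<le> p" by simp
  then have "real n * ln n / p \<le> 1" using p by (simp add: divide_le_eq)
  then have "exp (- 1) \<le> exp (- (real n * ln n / p))" by simp
  also have "\<dots> = (1 / real n) powr (real n / p)" using n by (simp add: powr_def ln_div)
  finally have "exp (- 1) \<le> (1 / real n) powr (real n / p)" .
  then have "real n * exp (- 1) \<le> real n * (1 / real n) powr (real n / p)" by (intro mult_left_mono) auto
  also have "\<dots> \<le> 2 * C" by (rule bernoulli_example[OF n(1) p C])
  finally have "real n * exp (- 1) \<le> 2 * C" .
  moreover have "K / 2 * exp (- 1) \<le> real n * exp (- 1)"
    using n by (intro mult_right_mono) auto
  moreover have "K / 2 * exp (- 1) = 2 * (exp (- 1) / 4 * K)" by simp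
  ultimately have "exp (- 1) / 4 * K \<le> C" by linarith
  then show ?thesis by (simp only: K_def)
qed

text \<open>The constant 8 exp 12 of \<open>upper_bound\<close> witnesses the existence on which the
  choice of \<open>c0\<close> rests.\<close>

lemma c0_properties: "0 < c0" "1 \<le> p \<Longrightarrow> upper_constant TYPE(nat \<Rightarrow> real) p (c0 * p / (1 + ln p))"
proof -
  have "0 < 8 * exp (12 :: real) \<and> (\<forall>p\<ge>1. upper_constant TYPE(nat \<Rightarrow> real) p (8 * exp 12 * p / (1 + ln p)))"
    unfolding upper_constant_def admissible_def
    by (auto intro!: norm_family.upper_bound norm_familyI)
  then have "0 < c0 \<and> (\<forall>p\<ge>1. upper_constant TYPE(nat \<Rightarrow> real) p (c0 * p / (1 + ln p)))"
    unfolding c0_def by (rule someI)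
  then show "0 < c0" "1 \<le> p \<Longrightarrow> upper_constant TYPE(nat \<Rightarrow> real) p (c0 * p / (1 + ln p))" by auto
qed

theorem theorem0p2:
  shows "0 < c0 \<and>
    (\<forall>p n N (M :: 'a measure) f.
       1 \<le> p \<and> 1 \<le> n \<and> normalized_symmetric_norm n N \<and>
       prob_space M \<and> prob_space.indep_vars M (\<lambda>_. borel) f {1..n} \<longrightarrow>
       ennreal (1 / (2 + 4 * sqrt 2)) * rearrangement_expr p n N M f \<le> moment_of_norm p N M f \<and>
       moment_of_norm p N M f \<le> ennreal (c0 * p / (1 + ln p)) * rearrangement_expr p n N M f) \<and>
    (\<exists>c>0. \<forall>p\<ge>1. \<forall>C. upper_constant TYPE(nat \<Rightarrow> real) p C \<longrightarrow> c * (p / (1 + ln p)) \<le> C)"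
proof (intro conjI allI impI)
  show "0 < c0" by (rule c0_properties)
  show "\<exists>c>0. \<forall>p\<ge>1. \<forall>C. upper_constant TYPE(nat \<Rightarrow> real) p C \<longrightarrow> c * (p / (1 + ln p)) \<le> C"
    using upper_constant_lower_bound by (intro exI[of _ "exp (- 1) / 4"]) auto
  fix p :: real and n N and M :: "'a measure" and f :: "nat \<Rightarrow> 'a \<Rightarrow> real"
  assume a: "1 \<le> p \<and> 1 \<le> n \<and> normalized_symmetric_norm n N \<and>
       prob_space M \<and> prob_space.indep_vars M (\<lambda>_. borel) f {1..n}"
  then interpret norm_family M f n N by (intro norm_familyI) auto
  show "ennreal (1 / (2 + 4 * sqrt 2)) * rearrangement_expr p n N M f \<le> moment_of_norm p N M f"
    using a by (intro lower_bound) simp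
  show "moment_of_norm p N M f \<le> ennreal (c0 * p / (1 + ln p)) * rearrangement_expr p n N M f"
    using a by (intro moment_le_of_upper_constant c0_properties) simp_all
qed

end
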